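(* Let $n,m\ge1$ be integers and let $\psi:\mathbb{N}\to\mathbb{R}^+$ satisfy $\psi(q)/q\to0$ as $q\to\infty$. Let $\pi$ be any partition of $\{1,\dots,m+n\}$ (into disjoint subsets each having at least two elements) and let $\Phi\in\mathbb{I}^{mm}\setminus\{\mathbf{0}\}$ and $\mathbf{y}\in\mathbb{I}^m$ be fixed. Let $f$ and $g:r\mapsto g(r):=r^{-m(n-1)}f(r)$ be dimension functions such that $r^{-nm}f(r)$ is monotonic, and define $\theta:\mathbb{N}\to\mathbb{R}^+$ by $\theta(q)=q\,g\!\left(\frac{\psi(q)}{q}\right)^{1/m}$. If $|\mathcal{M}^{\pi,\mathbf{y},\Phi}_{n,m}(\theta)|=1$, then $\mathcal{H}^f(\mathcal{M}^{\pi,\mathbf{y},\Phi}_{n,m}(\psi))=\mathcal{H}^f(\mathbb{I}^{nm})$.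
   Context: $\mathbb{I}^d=[0,1]^d$; $\mathbb{I}^{mm}$ is regarded as real $m\times m$ matrices with entries in $[0,1]$; $|X|$ is Lebesgue measure. Points $\mathbf{x}\in\mathbb{I}^{nm}$ are real $n\times m$ matrices; $\mathbf{q}\in\mathbb{Z}^n$, $\mathbf{p}\in\mathbb{Z}^m$ are row vectors; $|\cdot|$ is the supremum norm. For a subset $\sigma=\{i_1,\dots,i_\nu\}\subset\{1,\dots,d\}$ with $\nu\ge2$, $P(\sigma)$ is the set of $\mathbf{v}\in\mathbb{Z}^d$ with $\gcd(v_{i_1},\dots,v_{i_\nu})=1$; for a partition $\pi$ of $\{1,\dots,d\}$ into disjoint subsets $\pi_\ell$ of at least two elements, $P(\pi)$ is the set of $\mathbf{v}\in\mathbb{Z}^d$ with $\mathbf{v}\in P(\pi_\ell)$ for every component $\pi_\ell$. For $\phi:\mathbb{N}\to\mathbb{R}^+$, $\mathcal{M}^{\pi,\mathbf{y},\Phi}_{n,m}(\phi)$ is the set of $\mathbf{x}\in\mathbb{I}^{nm}$ such that $|\mathbf{q}\mathbf{x}+\mathbf{p}\Phi-\mathbf{y}|<\phi(|\mathbf{q}|)$ holds for $(\mathbf{p},\mathbf{q})\in(\mathbb{Z}^m\times\mathbb{Z}^n)\setminus\{\mathbf{0}\}$ with arbitrarily large $|\mathbf{q}|$ and with $(q_1,\dots,q_n,p_1,\dots,p_m)\in P(\pi)$. A dimension function is a left continuous, non-decreasing $f:\mathbb{R}^+\to\mathbb{R}^+$ with $f(r)\to0$ as $r\to0$; $\mathcal{H}^f$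 is Hausdorff $f$-measure. *)

theory Defs
  imports "HOL-Analysis.Analysis"
begin

section \<open>Dimension functions and Hausdorff measures\<close>

text \<open>
  A function from the positive reals to the positive reals is modelled by a total function on
  \<^typ>\<open>real\<close> that is only ever constrained, and only ever evaluated, at positive arguments.
\<close>

definition dimension_function :: "(real \<Rightarrow> real) \<Rightarrow> bool" where
  "dimension_function f \<longleftrightarrow>
     (\<forall>r>0. 0 < f r) \<and>
     mono_on {0<..} f \<and>
     (\<forall>r>0. continuous (at_left r) f) \<and>
     (f \<longlongrightarrow> 0) (at_right 0)"

text \<open>
  The value of a dimension function at 0 is its limit 0, so sets of diameter 0 (and in particular
  empty members of a cover) contribute nothing.
\<close>

definition gauge_value :: "(real \<Rightarrow> real) \<Rightarrow> real \<Rightarrow> ennreal" where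
  "gauge_value f r = (if r = 0 then 0 else ennreal (f r))"

text \<open>
  Covers are indexed by \<^typ>\<open>nat\<close>; finite covers are padded with empty sets. Boundedness is
  demanded explicitly because \<^const>\<open>diameter\<close> is meaningless on unbounded sets.
\<close>

definition hausdorff_premeasure ::
    "(real \<Rightarrow> real) \<Rightarrow> real \<Rightarrow> 'a::metric_space set \<Rightarrow> ennreal" where
  "hausdorff_premeasure f \<delta> A =
     (INF U \<in> {U :: nat \<Rightarrow> 'a set.
                 A \<subseteq> (\<Union>i. U i) \<and> (\<forall>i. bounded (U i) \<and> diameter (U i) \<le> \<delta>)}.
        \<Sum>i. gauge_value f (diameter (U i)))"

text \<open>The supremum is the limit as \<open>\<delta>\<close> tends to 0, the premeasure being antitone in \<open>\<delta>\<close>.\<close>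

definition hausdorff_measure :: "(real \<Rightarrow> real) \<Rightarrow> 'a::metric_space set \<Rightarrow> ennreal" where
  "hausdorff_measure f A = (SUP \<delta> \<in> {0<..}. hausdorff_premeasure f \<delta> A)"

lemma hausdorff_premeasure_antimono:
  "\<delta> \<le> \<delta>' \<Longrightarrow> hausdorff_premeasure f \<delta>' A \<le> hausdorff_premeasure f \<delta> A"
  unfolding hausdorff_premeasure_def by (rule INF_superset_mono) (auto intro: order_trans)

section \<open>Unit cubes and integer vectors\<close>

abbreviation unit_cube :: "'a::euclidean_space set" where
  "unit_cube \<equiv> cbox 0 One"

lemma mem_unit_cube: "x \<in> unit_cube \<longleftrightarrow> (\<forall>b\<in>Basis. 0 \<le> x \<bullet> b \<and> x \<bullet> b \<le> 1)"
  by (simp add: mem_box)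

lemma mem_unit_cube_vec:
  fixes y :: "real ^ 'm"
  shows "y \<in> unit_cube \<longleftrightarrow> (\<forall>j. 0 \<le> y $ j \<and> y $ j \<le> 1)"
  unfolding mem_unit_cube by (auto simp: Basis_vec_def inner_axis)

lemma mem_unit_cube_matrix:
  fixes x :: "real ^ 'm ^ 'n"
  shows "x \<in> unit_cube \<longleftrightarrow> (\<forall>i j. 0 \<le> x $ i $ j \<and> x $ i $ j \<le> 1)"
  unfolding mem_unit_cube by (auto simp: Basis_vec_def inner_axis)

definition real_vec :: "int ^ 'k \<Rightarrow> real ^ 'k" where
  "real_vec v = (\<chi> i. real_of_int (v $ i))"

definition int_sup_norm :: "int ^ 'k \<Rightarrow> nat" where
  "int_sup_norm v = (MAX i. nat \<bar>v $ i\<bar>)"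

definition append_vec :: "int ^ 'n \<Rightarrow> int ^ 'm \<Rightarrow> int ^ ('n + 'm)" where
  "append_vec q p = (\<chi> k. case k of Inl i \<Rightarrow> q $ i | Inr j \<Rightarrow> p $ j)"

section \<open>Primitivity with respect to a partition of the coordinates\<close>

definition primitive_on :: "'k set \<Rightarrow> (int ^ 'k) set" where
  "primitive_on \<sigma> = {v. Gcd ((\<lambda>i. v $ i) ` \<sigma>) = 1}"

definition primitive_wrt :: "'k set set \<Rightarrow> (int ^ 'k) set" where
  "primitive_wrt \<pi> = {v. \<forall>\<sigma>\<in>\<pi>. v \<in> primitive_on \<sigma>}"

definition admissible_partition :: "'k::finite set set \<Rightarrow> bool" where
  "admissible_partition \<pi> \<longleftrightarrow> partition_on UNIV \<pi> \<and> (\<forall>\<sigma>\<in>\<pi>. 2 \<le> card \<sigma>)"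

section \<open>Approximable systems of linear forms\<close>

text \<open>
  An \<open>n \<times> m\<close> matrix has type \<^typ>\<open>real ^ 'm ^ 'n\<close>, so \<open>q v* x\<close> is the row vector \<open>q\<close> times \<open>x\<close>.
  The index set \<open>{1, \<dots>, n + m}\<close> of \<open>(q, p)\<close> is the disjoint sum \<^typ>\<open>'n + 'm\<close>.
  The value \<open>\<phi> 0\<close> plays no role, since only arbitrarily large \<open>int_sup_norm q\<close> matter.
\<close>

definition approximable ::
    "('n::finite + 'm::finite) set set \<Rightarrow> real ^ 'm \<Rightarrow> real ^ 'm ^ 'm \<Rightarrow> (nat \<Rightarrow> real) \<Rightarrow>
     (real ^ 'm ^ 'n) set" where
  "approximable \<pi> y \<Phi> \<phi> =
     {x \<in> unit_cube. \<forall>N. \<exists>(p :: int ^ 'm) (q :: int ^ 'n).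
        (p, q) \<noteq> (0, 0) \<and> N \<le> int_sup_norm q \<and> append_vec q p \<in> primitive_wrt \<pi> \<and>
        infnorm (real_vec q v* x + real_vec p v* \<Phi> - y) < \<phi> (int_sup_norm q)}"

end

theory Submission
  imports Defs
begin

text \<open>
  For fixed \<open>(p, q)\<close> the condition on \<open>x\<close> defines a slab around an affine subspace of codimension \<open>m\<close>,
  of width \<open>\<Upsilon> = \<psi>(|q|)/|q|\<close> respectively \<open>\<Theta> = \<theta>(|q|)/|q|\<close>, where \<open>\<Theta>\<^sup>m = g(\<Upsilon>)\<close>.

  If \<open>f(r)/r\<^sup>n\<^sup>m\<close> is bounded near 0, then \<open>\<Theta> \<le> K \<Upsilon>\<close>, so a ball of radius comparable to \<open>\<Theta>\<close> around a point
  of a \<open>\<Theta>\<close>-slab meets the \<open>\<Upsilon>\<close>-slab in a fixed proportion. By the Lebesgue density theorem the limsup set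
  for \<open>\<psi>\<close> has full measure too, and null sets are \<open>\<H>\<^sup>f\<close>-null.

  Otherwise \<open>f(r)/r\<^sup>n\<^sup>m\<close> increases to infinity as \<open>r\<close> decreases to 0, and the measure is infinite on both
  sides. Indeed, finite \<open>\<H>\<^sup>f\<close>-measure would give a cover \<open>W\<close> of the limsup set by balls of radii \<open>r\<^sub>j\<close> with
  \<open>\<Sum> f(r\<^sub>j)\<close> finite and \<open>W\<close> of Lebesgue measure less than 1. At almost every point \<open>x\<close> outside \<open>W\<close> the balls
  meeting a ball of radius \<open>C\<Theta>\<close> around \<open>x\<close> have \<open>\<Sum> f(r\<^sub>j)\<close> small compared with \<open>\<Theta>\<^sup>n\<^sup>m\<close>, and then they are too
  few to cover the part of the \<open>\<Upsilon>\<close>-slab in that ball. Hence each level of the limsup set is relatively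
  open and dense in the support of Lebesgue measure on the complement of \<open>W\<close>, and Baire's theorem
  produces a point of the limsup set outside \<open>W\<close>.
\<close>

section \<open>Averages of a function at its zeros\<close>

text \<open>This is Vitali's covering lemma applied to the balls of radius below
  \<open>\<delta>\<close> that satisfy \<open>P\<close> and lie in \<open>U\<close>. Such balls are
  centred at every point of \<open>E\<close>, since \<open>U\<close> is open and \<open>P\<close>
  holds at arbitrarily small radii.\<close>

lemma disjoint_fine_balls:
  fixes E :: "'a::euclidean_space set"
  assumes "open U" "E \<subseteq> U" "0 < \<delta>"
    and fine: "\<And>x d. x \<in> E \<Longrightarrow> 0 < d \<Longrightarrow> \<exists>\<rho>. 0 < \<rho> \<and> \<rho> < d \<and> P x \<rho>"
  obtains a :: "nat \<Rightarrow> 'a" and \<rho> :: "nat \<Rightarrow> real" where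
    "\<And>i. 0 \<le> \<rho> i" "\<And>i. \<rho> i < \<delta>" "\<And>i. 0 < \<rho> i \<Longrightarrow> P (a i) (\<rho> i)"
    "disjoint_family (\<lambda>i. ball (a i) (\<rho> i))" "\<And>i. ball (a i) (\<rho> i) \<subseteq> U"
    "E \<subseteq> (\<Union>i. ball (a i) (5 * \<rho> i))"
proof -
  define K where "K = {(x, r). 0 < r \<and> r < \<delta> \<and> P x r \<and> ball x r \<subseteq> U}"
  have "E \<subseteq> (\<Union>k\<in>K. ball (fst k) (snd k))"
  proof
    fix x assume x: "x \<in> E"
    then obtain e where e: "0 < e" "ball x e \<subseteq> U"
      using assms(1,2) by (metis openE subsetD)
    obtain r where "0 < r" "r < min \<delta> e" "P x r"
      using fine[OF x, of "min \<delta> e"] e assms(3) by auto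
    then have "(x, r) \<in> K" using e by (auto simp: K_def)
    with \<open>0 < r\<close> show "x \<in> (\<Union>k\<in>K. ball (fst k) (snd k))" by force
  qed
  moreover have "0 < snd k \<and> snd k \<le> \<delta>" if "k \<in> K" for k using that by (auto simp: K_def)
  ultimately obtain C where C: "countable C" "C \<subseteq> K"
     "pairwise (\<lambda>i j. disjnt (ball (fst i) (snd i)) (ball (fst j) (snd j))) C"
     "E \<subseteq> (\<Union>i\<in>C. ball (fst i) (5 * snd i))"
    by (rule Vitali_covering_lemma_balls)
  define c where "c n = (if n \<in> to_nat_on C ` C then from_nat_into C n else (0, 0))" for n
  have inC: "c n \<in> C" "to_nat_on C (c n) = n" if "0 < snd (c n)" for n
    using that C(1) by (auto simp: c_def split: if_splits)
  have surj: "\<exists>n. c n = k" if "k \<in> C" for k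
    using that C(1) by (intro exI[of _ "to_nat_on C k"]) (auto simp: c_def)
  have nn: "0 \<le> snd (c n)" for n
    using C(1,2) by (auto simp: c_def K_def)
  show ?thesis
  proof
    show "0 \<le> snd (c i)" for i by (rule nn)
    show "snd (c i) < \<delta>" for i
    proof (cases "0 < snd (c i)")
      case True then show ?thesis using inC C(2) by (fastforce simp: K_def)
    next
      case False then show ?thesis using assms(3) by linarith
    qed
    show "P (fst (c i)) (snd (c i))" if "0 < snd (c i)" for i
      using inC(1)[OF that] C(2) by (fastforce simp: K_def)
    show "ball (fst (c i)) (snd (c i)) \<subseteq> U" for i
    proof (cases "0 < snd (c i)")
      case True then show ?thesis using inC C(2) by (fastforce simp: K_def)
    next
      case False then show ?thesis by (simp add: ball_empty)
    qed
    show "disjoint_family (\<lambda>i. ball (fst (c i)) (snd (c i)))"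
      unfolding disjoint_family_on_def
    proof (intro ballI impI)
      fix i j :: nat assume "i \<noteq> j"
      show "ball (fst (c i)) (snd (c i)) \<inter> ball (fst (c j)) (snd (c j)) = {}"
      proof (cases "0 < snd (c i) \<and> 0 < snd (c j)")
        case True
        then have "c i \<in> C" "c j \<in> C" "c i \<noteq> c j" using inC \<open>i \<noteq> j\<close> by (auto, metis)
        then show ?thesis using C(3) by (auto simp: pairwise_def disjnt_def)
      next
        case False then show ?thesis by (metis ball_empty inf_bot_left inf_bot_right not_le)
      qed
    qed
    show "E \<subseteq> (\<Union>i. ball (fst (c i)) (5 * snd (c i)))"
    proof
      fix x assume "x \<in> E"
      then obtain k where "k \<in> C" "x \<in> ball (fst k) (5 * snd k)" using C(4) by blast
      then show "x \<in> (\<Union>i. ball (fst (c i)) (5 * snd (c i)))" using surj[of k] by auto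
    qed
  qed
qed

text \<open>The measure \<open>\<nu>\<close> with density \<open>w\<close> gives no mass to the
  zeros of \<open>w\<close>, so by outer regularity they lie in an open set of small
  \<open>\<nu>\<close>-mass. Disjoint balls in it with \<open>\<nu>\<close>-mass above
  \<open>\<eta>\<close> times a power of the radius have small total volume, and so do their 5-fold
  enlargements, which cover the exceptional points. This takes the place of the Lebesgue density
  theorem, both for indicators of open sets and for mass spread over a cover.\<close>

lemma negligible_zero_of_high_density:
  fixes w :: "'a::euclidean_space \<Rightarrow> ennreal"
  assumes w [measurable]: "w \<in> borel_measurable borel"
    and fin: "(\<integral>\<^sup>+x. w x \<partial>lborel) < \<infinity>"
  shows "negligible {x. w x = 0 \<and> (\<exists>\<eta>>0. \<forall>d>0. \<exists>\<rho>. 0 < \<rho> \<and> \<rho> < d \<and>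
            ennreal (\<eta> * \<rho> ^ DIM('a)) < (\<integral>\<^sup>+z\<in>ball x \<rho>. w z \<partial>lborel))}"
proof -
  define \<nu> where "\<nu> = density lborel w"
  have [simp]: "sets \<nu> = sets borel" "space \<nu> = UNIV" by (auto simp: \<nu>_def)
  have nu: "emeasure \<nu> S = (\<integral>\<^sup>+z\<in>S. w z \<partial>lborel)" if "S \<in> sets borel" for S
    using that by (simp add: \<nu>_def emeasure_density)
  have nu_fin: "emeasure \<nu> (space \<nu>) \<noteq> \<infinity>" using fin nu[of UNIV] by simp
  define Z where "Z = {x. w x = 0}"
  have Z[measurable]: "Z \<in> sets borel" unfolding Z_def by measurable
  have nuZ: "emeasure \<nu> Z = 0"
    unfolding nu[OF Z] by (subst nn_integral_0_iff_AE) (auto simp: Z_def indicator_def)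
  define E where "E \<eta> = {x \<in> Z. \<forall>d>0. \<exists>\<rho>. 0 < \<rho> \<and> \<rho> < d \<and>
            ennreal (\<eta> * \<rho> ^ DIM('a)) < emeasure \<nu> (ball x \<rho>)}" for \<eta>
  have negE: "negligible (E \<eta>)" if eta: "0 < \<eta>" for \<eta>
    unfolding negligible_outer_le
  proof (intro allI impI)
    fix e :: real assume e: "0 < e"
    define V where "V = unit_ball_vol (real DIM('a))"
    have V: "0 < V" by (simp add: V_def)
    \<comment> \<open>Chosen so that the volume of the enlarged balls, at most
      \<open>V * 5 ^ DIM('a) / \<eta>\<close> times \<open>\<nu>(U)\<close>, stays within
      \<open>e\<close>.\<close>
    define \<epsilon> where "\<epsilon> = e * \<eta> / (V * 5 ^ DIM('a))"
    have eps: "0 < \<epsilon>" using e eta V by (simp add: \<epsilon>_def)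
    have "(INF U \<in> {U. Z \<subseteq> U \<and> open U}. emeasure \<nu> U) = 0"
      using outer_regular[of \<nu> Z] nu_fin nuZ by simp
    then obtain U where U: "Z \<subseteq> U" "open U" "emeasure \<nu> U < ennreal \<epsilon>"
      using eps by (metis (mono_tags, lifting) Inf_less_iff ennreal_less_zero_iff image_iff mem_Collect_eq)
    obtain a :: "nat \<Rightarrow> 'a" and \<rho> where ar: "\<And>i. 0 \<le> \<rho> i"
       "\<And>i. 0 < \<rho> i \<Longrightarrow> ennreal (\<eta> * \<rho> i ^ DIM('a)) < emeasure \<nu> (ball (a i) (\<rho> i))"
       "disjoint_family (\<lambda>i. ball (a i) (\<rho> i))" "\<And>i. ball (a i) (\<rho> i) \<subseteq> U"
       "E \<eta> \<subseteq> (\<Union>i. ball (a i) (5 * \<rho> i))"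
    proof (rule disjoint_fine_balls[of U "E \<eta>" 1 "\<lambda>x r. ennreal (\<eta> * r ^ DIM('a)) < emeasure \<nu> (ball x r)"])
      show "E \<eta> \<subseteq> U" using U(1) by (auto simp: E_def)
    qed (use U in \<open>auto simp: E_def\<close>)
    let ?T = "\<Union>i. ball (a i) (5 * \<rho> i)"
    have "emeasure lborel ?T \<le> (\<Sum>i. emeasure lborel (ball (a i) (5 * \<rho> i)))"
      by (rule emeasure_subadditive_countably) auto
    also have "\<dots> \<le> (\<Sum>i. ennreal (V * 5 ^ DIM('a) / \<eta>) * emeasure \<nu> (ball (a i) (\<rho> i)))"
    proof (rule suminf_le)
      fix i
      have "emeasure lborel (ball (a i) (5 * \<rho> i)) = ennreal (V * 5 ^ DIM('a) / \<eta>) * ennreal (\<eta> * \<rho> i ^ DIM('a))"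
        using ar(1)[of i] eta V
        by (simp add: emeasure_ball V_def power_mult_distrib flip: ennreal_mult')
      also have "\<dots> \<le> ennreal (V * 5 ^ DIM('a) / \<eta>) * emeasure \<nu> (ball (a i) (\<rho> i))"
      proof (rule mult_left_mono)
        show "ennreal (\<eta> * \<rho> i ^ DIM('a)) \<le> emeasure \<nu> (ball (a i) (\<rho> i))"
          using ar(2)[of i] ar(1)[of i] by (cases "\<rho> i = 0") (auto simp: zero_power intro: less_imp_le)
      qed simp
      finally show "emeasure lborel (ball (a i) (5 * \<rho> i)) \<le> \<dots>" .
    qed auto
    also have "\<dots> = ennreal (V * 5 ^ DIM('a) / \<eta>) * (\<Sum>i. emeasure \<nu> (ball (a i) (\<rho> i)))"
      by (rule ennreal_suminf_cmult)
    also have "(\<Sum>i. emeasure \<nu> (ball (a i) (\<rho> i))) = emeasure \<nu> (\<Union>i. ball (a i) (\<rho> i))"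
      using ar(3) by (intro suminf_emeasure) auto
    also have "\<dots> \<le> emeasure \<nu> U" using ar(4) U(2) by (intro emeasure_mono) auto
    also have "\<dots> \<le> ennreal \<epsilon>" using U(3) by simp
    also have "ennreal (V * 5 ^ DIM('a) / \<eta>) * ennreal \<epsilon> = ennreal e"
      using V eta e by (simp add: \<epsilon>_def flip: ennreal_mult')
    finally have le: "emeasure lborel ?T \<le> ennreal e" by (auto simp: mult_left_mono)
    have T: "?T \<in> sets lborel" by simp
    have "?T \<in> lmeasurable"
      using le by (intro fmeasurableI) (auto intro: le_less_trans)
    moreover have "measure lebesgue ?T \<le> e"
      using le e by (simp add: measure_def enn2real_leI)
    ultimately show "\<exists>T. E \<eta> \<subseteq> T \<and> T \<in> lmeasurable \<and> measure lebesgue T \<le> e"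
      using ar(5) by blast
  qed
  \<comment> \<open>It suffices to let the density threshold run through the reciprocals of the
    positive integers, which leaves a countable union.\<close>
  have "{x. w x = 0 \<and> (\<exists>\<eta>>0. \<forall>d>0. \<exists>\<rho>. 0 < \<rho> \<and> \<rho> < d \<and>
            ennreal (\<eta> * \<rho> ^ DIM('a)) < (\<integral>\<^sup>+z\<in>ball x \<rho>. w z \<partial>lborel))} \<subseteq> (\<Union>n. E (inverse (real (Suc n))))"
  proof clarsimp
    fix x \<eta> assume x: "w x = 0" and eta: "(0::real) < \<eta>" and
      H: "\<forall>d>0. \<exists>\<rho>>0. \<rho> < d \<and> ennreal (\<eta> * \<rho> ^ DIM('a)) < (\<integral>\<^sup>+z\<in>ball x \<rho>. w z \<partial>lborel)"
    obtain n where n: "inverse (real (Suc n)) < \<eta>" using reals_Archimedean eta by blast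
    have "x \<in> E (inverse (real (Suc n)))"
      unfolding E_def
    proof (clarify, intro conjI allI impI)
      show "x \<in> Z" using x by (simp add: Z_def)
      fix d :: real assume "0 < d"
      then obtain \<rho> where r: "\<rho>>0" "\<rho> < d" "ennreal (\<eta> * \<rho> ^ DIM('a)) < emeasure \<nu> (ball x \<rho>)"
        using H by (auto simp: nu)
      have "ennreal (inverse (real (Suc n)) * \<rho> ^ DIM('a)) \<le> ennreal (\<eta> * \<rho> ^ DIM('a))"
        using n r by (intro ennreal_leI mult_right_mono) auto
      then show "\<exists>\<rho>>0. \<rho> < d \<and> ennreal (inverse (real (Suc n)) * \<rho> ^ DIM('a)) < emeasure \<nu> (ball x \<rho>)"
        using r by (meson le_less_trans)
    qed
    then show "\<exists>n. x \<in> E (inverse (1 + real n))" by auto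
  qed
  moreover have "negligible (\<Union>n. E (inverse (real (Suc n))))"
    by (rule negligible_countable_Union) (auto intro: negE)
  ultimately show ?thesis by (rule negligible_subset[rotated])
qed

section \<open>Hausdorff measures\<close>

lemma hausdorff_measure_mono:
  "A \<subseteq> B \<Longrightarrow> hausdorff_measure f A \<le> hausdorff_measure f B"
  unfolding hausdorff_measure_def hausdorff_premeasure_def
  by (intro SUP_mono' INF_superset_mono) auto

text \<open>Two covers are interleaved, one at the even and one at the odd indices; the first
  \<open>2 * n\<close> terms of the combined series split into the two partial sums.\<close>

lemma hausdorff_premeasure_Un:
  fixes A B :: "'a::metric_space set"
  shows "hausdorff_premeasure f \<delta> (A \<union> B) \<le> hausdorff_premeasure f \<delta> A + hausdorff_premeasure f \<delta> B"
proof -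
  let ?cov = "\<lambda>A. {U :: nat \<Rightarrow> 'a set. A \<subseteq> (\<Union>i. U i) \<and> (\<forall>i. bounded (U i) \<and> diameter (U i) \<le> \<delta>)}"
  let ?v = "\<lambda>U. \<Sum>i. gauge_value f (diameter (U i))"
  have pair: "hausdorff_premeasure f \<delta> (A \<union> B) \<le> ?v U + ?v V"
    if U: "U \<in> ?cov A" and V: "V \<in> ?cov B" for U V
  proof -
    define W where "W n = (if even n then U (n div 2) else V (n div 2))" for n
    have "U i \<subseteq> \<Union>(range W)" "V i \<subseteq> \<Union>(range W)" for i
      using UN_upper[of "2 * i" UNIV W] UN_upper[of "2 * i + 1" UNIV W] by (simp_all add: W_def)
    then have "(\<Union>i. U i) \<subseteq> (\<Union>i. W i)" "(\<Union>i. V i) \<subseteq> (\<Union>i. W i)" by blast+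
    then have "A \<union> B \<subseteq> (\<Union>i. W i)" using U V by blast
    moreover have "bounded (W i) \<and> diameter (W i) \<le> \<delta>" for i using U V by (simp add: W_def)
    ultimately have W: "W \<in> ?cov (A \<union> B)" by simp
    have double: "(\<Sum>i<2 * n. gauge_value f (diameter (W i))) =
       (\<Sum>i<n. gauge_value f (diameter (U i))) + (\<Sum>i<n. gauge_value f (diameter (V i)))" for n
      by (induction n) (simp_all add: W_def ac_simps)
    have "hausdorff_premeasure f \<delta> (A \<union> B) \<le> ?v W"
      unfolding hausdorff_premeasure_def by (rule INF_lower[OF W])
    also have "?v W \<le> ?v U + ?v V"
    proof (rule suminf_le_const)
      fix n
      have "(\<Sum>i<n. gauge_value f (diameter (W i))) \<le> (\<Sum>i<2 * n. gauge_value f (diameter (W i)))"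
        by (rule sum_mono2) auto
      also have "\<dots> \<le> ?v U + ?v V"
        unfolding double by (intro add_mono sum_le_suminf) auto
      finally show "(\<Sum>i<n. gauge_value f (diameter (W i))) \<le> ?v U + ?v V" .
    qed auto
    finally show ?thesis .
  qed
  show ?thesis
  proof (rule ennreal_le_epsilon)
    fix e :: real assume fin: "hausdorff_premeasure f \<delta> A + hausdorff_premeasure f \<delta> B < top" and e: "0 < e"
    have ex: "\<exists>U \<in> ?cov X. ?v U < hausdorff_premeasure f \<delta> X + ennreal (e / 2)"
      if "hausdorff_premeasure f \<delta> X < top" for X
    proof -
      have "hausdorff_premeasure f \<delta> X < hausdorff_premeasure f \<delta> X + ennreal (e / 2)"
        using that e ennreal_add_left_cancel_less[of "hausdorff_premeasure f \<delta> X" 0 "ennreal (e / 2)"]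
        by (auto simp: ennreal_less_zero_iff)
      then show ?thesis by (subst (asm) hausdorff_premeasure_def) (simp only: INF_less_iff)
    qed
    have fin2: "hausdorff_premeasure f \<delta> A < top" "hausdorff_premeasure f \<delta> B < top"
      using fin by (auto simp: ennreal_add_less_top)
    obtain U V where U: "U \<in> ?cov A" "?v U < hausdorff_premeasure f \<delta> A + ennreal (e / 2)"
      and V: "V \<in> ?cov B" "?v V < hausdorff_premeasure f \<delta> B + ennreal (e / 2)"
      using ex[OF fin2(1)] ex[OF fin2(2)] by blast
    have "hausdorff_premeasure f \<delta> (A \<union> B) \<le> ?v U + ?v V" by (rule pair[OF U(1) V(1)])
    also have "\<dots> \<le> (hausdorff_premeasure f \<delta> A + ennreal (e / 2)) + (hausdorff_premeasure f \<delta> B + ennreal (e / 2))"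
      using U(2) V(2) by (intro add_mono) auto
    also have "\<dots> = hausdorff_premeasure f \<delta> A + hausdorff_premeasure f \<delta> B + (ennreal (e / 2) + ennreal (e / 2))"
      by (simp add: ac_simps)
    also have "ennreal (e / 2) + ennreal (e / 2) = ennreal e" using e by (simp flip: ennreal_plus)
    finally show "hausdorff_premeasure f \<delta> (A \<union> B) \<le>
        hausdorff_premeasure f \<delta> A + hausdorff_premeasure f \<delta> B + ennreal e" .
  qed
qed

lemma hausdorff_measure_Un_null:
  fixes A B :: "'a::metric_space set"
  assumes "hausdorff_measure f B = 0"
  shows "hausdorff_measure f (A \<union> B) = hausdorff_measure f A"
proof (rule antisym)
  show "hausdorff_measure f (A \<union> B) \<le> hausdorff_measure f A"
    unfolding hausdorff_measure_def
  proof (rule SUP_mono)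
    fix \<delta> :: real assume d: "\<delta> \<in> {0<..}"
    then have "hausdorff_premeasure f \<delta> B \<le> hausdorff_measure f B"
      unfolding hausdorff_measure_def by (rule SUP_upper)
    then have "hausdorff_premeasure f \<delta> B = 0" using assms by simp
    then show "\<exists>\<delta>'\<in>{0<..}. hausdorff_premeasure f \<delta> (A \<union> B) \<le> hausdorff_premeasure f \<delta>' A"
      using hausdorff_premeasure_Un[of f \<delta> A B] d by auto
  qed
qed (rule hausdorff_measure_mono, simp)

text \<open>The 5-fold enlargements of disjoint balls inside an open set of small volume cover
  \<open>Z\<close>. The bound on \<open>f\<close> makes the gauge of each enlargement at most a
  constant times the volume of the original ball, and these volumes add up to at most that of the
  open set.\<close>

lemma hausdorff_measure_negligible:
  fixes Z :: "'a::euclidean_space set"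
  assumes Z: "negligible Z" and K: "\<And>r. 0 < r \<Longrightarrow> r \<le> 1 \<Longrightarrow> f r \<le> K * r ^ DIM('a)"
  shows "hausdorff_measure f Z = 0"
proof -
  have "hausdorff_premeasure f \<delta> Z \<le> 0 + ennreal e" if d: "0 < \<delta>" and e: "0 < e" for \<delta> e
  proof -
    define V where "V = unit_ball_vol (real DIM('a))"
    have V: "0 < V" by (simp add: V_def)
    \<comment> \<open>The 10 is the diameter of an enlarged ball divided by the original radius.
      Adding 1 to the absolute value of \<open>K\<close> keeps \<open>C\<close> positive for
      division.\<close>
    define C where "C = (\<bar>K\<bar> + 1) * 10 ^ DIM('a) / V"
    have C: "0 < C" using V by (simp add: C_def)
    have "Z \<in> sets lebesgue" using Z negligible_imp_sets by blast
    then obtain U where U: "open U" "Z \<subseteq> U" "emeasure lebesgue (U - Z) < ennreal (e / C)"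
      by (rule sets_lebesgue_outer_open[of Z "e / C"]) (use e C in simp)
    have "emeasure lborel U = emeasure lebesgue U" using U(1) by simp
    also have "\<dots> = emeasure lebesgue (U - Z)"
      using Z U by (intro emeasure_Diff_null_set[symmetric]) (auto simp: negligible_iff_null_sets)
    finally have U3: "emeasure lborel U < ennreal (e / C)" using U(3) by simp
    \<comment> \<open>Radii below \<open>min \<delta> 1 / 10\<close> keep the enlarged diameters
      within \<open>\<delta>\<close> and within the range where the bound on \<open>f\<close> is
      available.\<close>
    obtain a :: "nat \<Rightarrow> 'a" and \<rho> where ar: "\<And>i. 0 \<le> \<rho> i" "\<And>i. \<rho> i < min \<delta> 1 / 10"
       "disjoint_family (\<lambda>i. ball (a i) (\<rho> i))" "\<And>i. ball (a i) (\<rho> i) \<subseteq> U"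
       "Z \<subseteq> (\<Union>i. ball (a i) (5 * \<rho> i))"
    proof (rule disjoint_fine_balls[of U Z "min \<delta> 1 / 10" "\<lambda>_ _. True"])
      show "\<exists>\<rho>>0. \<rho> < d \<and> True" if "0 < d" for d :: real using dense[OF that] by simp
    qed (use U d in auto)
    have diam: "diameter (ball (a i) (5 * \<rho> i)) = 10 * \<rho> i" for i using ar(1)[of i] by simp
    have "hausdorff_premeasure f \<delta> Z \<le> (\<Sum>i. gauge_value f (diameter (ball (a i) (5 * \<rho> i))))"
      unfolding hausdorff_premeasure_def
    proof (rule INF_lower, clarify, intro conjI allI)
      show "Z \<subseteq> (\<Union>i. ball (a i) (5 * \<rho> i))" by (rule ar(5))
      show "diameter (ball (a i) (5 * \<rho> i)) \<le> \<delta>" for i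
        unfolding diam using ar(2)[of i] by simp
    qed auto
    also have "\<dots> \<le> (\<Sum>i. ennreal C * emeasure lborel (ball (a i) (\<rho> i)))"
    proof (rule suminf_le)
      fix i
      show "gauge_value f (diameter (ball (a i) (5 * \<rho> i))) \<le> ennreal C * emeasure lborel (ball (a i) (\<rho> i))"
      proof (cases "\<rho> i = 0")
        case False
        then have r: "0 < \<rho> i" "10 * \<rho> i \<le> 1" using ar(1,2)[of i] by auto
        have "f (10 * \<rho> i) \<le> K * (10 * \<rho> i) ^ DIM('a)" using r by (intro K) auto
        also have "\<dots> \<le> (\<bar>K\<bar> + 1) * (10 * \<rho> i) ^ DIM('a)" using r by (intro mult_right_mono) auto
        also have "\<dots> = C * (V * \<rho> i ^ DIM('a))" using V by (simp add: C_def power_mult_distrib)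
        finally have "ennreal (f (10 * \<rho> i)) \<le> ennreal C * ennreal (V * \<rho> i ^ DIM('a))"
          using C by (simp add: ennreal_leI flip: ennreal_mult')
        then show ?thesis unfolding diam using r by (simp add: gauge_value_def emeasure_ball V_def)
      qed (simp add: gauge_value_def)
    qed auto
    also have "\<dots> = ennreal C * (\<Sum>i. emeasure lborel (ball (a i) (\<rho> i)))"
      by (rule ennreal_suminf_cmult)
    also have "(\<Sum>i. emeasure lborel (ball (a i) (\<rho> i))) = emeasure lborel (\<Union>i. ball (a i) (\<rho> i))"
      using ar(3) by (intro suminf_emeasure) auto
    also have "\<dots> \<le> emeasure lborel U" using ar(4) U(1) by (intro emeasure_mono) auto
    also have "\<dots> \<le> ennreal (e / C)" using U3 by simp
    also have "ennreal C * ennreal (e / C) = ennreal e" using C e by (simp flip: ennreal_mult')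
    finally show ?thesis by (auto simp: mult_left_mono)
  qed
  then have "hausdorff_premeasure f \<delta> Z \<le> 0" if "0 < \<delta>" for \<delta>
    using that by - (rule ennreal_le_epsilon, blast)
  then show ?thesis by (simp add: hausdorff_measure_def)
qed

text \<open>Each set of an economical cover is put into a ball of twice its diameter. Since
  \<open>f r / r ^ DIM('a)\<close> is decreasing, doubling the argument costs at most a factor
  \<open>2 ^ DIM('a)\<close>. Since that quotient is unbounded, at small scales volume is a tiny
  fraction of gauge, so a bounded gauge sum forces small total volume.\<close>

lemma small_ball_cover:
  fixes M :: "'a::euclidean_space set"
  assumes f: "dimension_function f"
    and anti: "\<And>r s. 0 < r \<Longrightarrow> r \<le> s \<Longrightarrow> f s * r ^ DIM('a) \<le> f r * s ^ DIM('a)"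
    and unbounded: "\<And>K. \<exists>r. 0 < r \<and> r \<le> 1 \<and> K * r ^ DIM('a) < f r"
    and fin: "hausdorff_measure f M < \<infinity>" and e: "0 < e"
  obtains u :: "nat \<Rightarrow> 'a" and r :: "nat \<Rightarrow> real" where
    "\<And>i. 0 < r i" "\<And>i. r i \<le> 1" "(\<Sum>i. ennreal (f (r i))) < \<infinity>"
    "M \<subseteq> (\<Union>i. ball (u i) (r i))" "emeasure lborel (\<Union>i. ball (u i) (r i)) \<le> ennreal e"
proof -
  define k where "k = DIM('a)"
  define V where "V = unit_ball_vol (real DIM('a))"
  have V: "0 < V" by (simp add: V_def)
  have f_pos: "0 < f r" if "0 < r" for r using f that by (simp add: dimension_function_def)
  obtain S where S: "0 \<le> S" "hausdorff_measure f M = ennreal S"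
    using fin by (cases "hausdorff_measure f M") auto
  \<comment> \<open>Bound for the final gauge sum: \<open>2 ^ k\<close> from doubling the diameters,
    and the summand 2 from the geometric series spent on sets of diameter 0.\<close>
  define B where "B = 2 ^ k * (S + 1) + 2"
  have B: "0 < B" using S by (auto simp: B_def intro: add_nonneg_pos)
  define K where "K = V * B / e"
  have K: "0 < K" using V B e by (simp add: K_def)
  obtain r0 where r0: "0 < r0" "r0 \<le> 1" "K * r0 ^ k < f r0" using unbounded[of K] by (auto simp: k_def)
  \<comment> \<open>A single radius with large quotient controls all smaller ones, as the quotient
    increases towards 0.\<close>
  have fK: "K * r ^ k \<le> f r" if r: "0 < r" "r \<le> r0" for r
  proof -
    have "K * r ^ k * r0 ^ k = K * r0 ^ k * r ^ k" by simp
    also have "\<dots> \<le> f r0 * r ^ k" using r0 r by (intro mult_right_mono) auto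
    also have "\<dots> \<le> f r * r0 ^ k" using anti[OF r] by (simp add: k_def)
    finally show ?thesis using r0 by simp
  qed
  \<comment> \<open>The scale is \<open>r0 / 2\<close> so that the doubled diameters still satisfy
    \<open>fK\<close>.\<close>
  have "hausdorff_premeasure f (r0 / 2) M \<le> hausdorff_measure f M"
    unfolding hausdorff_measure_def using r0 by (intro SUP_upper) auto
  also have "\<dots> < ennreal (S + 1)" using S by (simp add: ennreal_lessI)
  finally obtain U :: "nat \<Rightarrow> 'a set" where U: "M \<subseteq> (\<Union>i. U i)" "\<And>i. bounded (U i)"
      "\<And>i. diameter (U i) \<le> r0 / 2" "(\<Sum>i. gauge_value f (diameter (U i))) < ennreal (S + 1)"
    unfolding hausdorff_premeasure_def INF_less_iff by auto
  \<comment> \<open>Sets of diameter 0 need balls of positive radius too; these are taken so small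
    that their gauges are summable.\<close>
  have "\<exists>t. 0 < t \<and> t \<le> r0 \<and> f t \<le> (1/2) ^ i" for i :: nat
  proof -
    have "\<forall>\<^sub>F t in at_right 0. f t < (1/2) ^ i"
      using f by (intro order_tendstoD(2)[of f 0]) (auto simp: dimension_function_def)
    then obtain b where b: "b > 0" "\<And>t. 0 < t \<Longrightarrow> t < b \<Longrightarrow> f t < (1/2) ^ i"
      by (auto simp: eventually_at_right_field)
    show ?thesis using b r0 by (intro exI[of _ "min (b/2) r0"]) (auto intro!: less_imp_le b(2))
  qed
  then obtain t where t: "\<And>i. 0 < t i" "\<And>i. t i \<le> r0" "\<And>i. f (t i) \<le> (1/2) ^ i" by metis
  define r where "r i = (if diameter (U i) = 0 then t i else 2 * diameter (U i))" for i
  \<comment> \<open>For an empty \<open>U i\<close> the centre is arbitrary. Otherwise it lies in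
    \<open>U i\<close>, and the factor 2 in \<open>r\<close> makes the open ball contain all of
    \<open>U i\<close>.\<close>
  define u where "u i = (SOME x. x \<in> U i)" for i
  have diam_nn: "0 \<le> diameter (U i)" for i using U(2) by (rule diameter_ge_0)
  have r_pos: "0 < r i" for i using t(1)[of i] diam_nn[of i] by (auto simp: r_def)
  have r_le: "r i \<le> r0" for i using t(2)[of i] U(3)[of i] by (auto simp: r_def)
  have fr: "ennreal (f (r i)) \<le> ennreal (2 ^ k) * gauge_value f (diameter (U i)) + ennreal ((1/2) ^ i)" for i
  proof (cases "diameter (U i) = 0")
    case True
    then show ?thesis using t(3)[of i] by (auto simp: r_def gauge_value_def intro: ennreal_leI)
  next
    case False
    define d where "d = diameter (U i)"
    have d: "0 < d" using False diam_nn[of i] by (simp add: d_def)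
    have "f (2 * d) * d ^ k \<le> f d * (2 * d) ^ k" using anti[of d "2 * d"] d by (simp add: k_def)
    then have "f (2 * d) \<le> 2 ^ k * f d" using d by (simp add: power_mult_distrib mult.commute mult.left_commute)
    then have "ennreal (f (2 * d)) \<le> ennreal (2 ^ k) * ennreal (f d)"
      using f_pos[OF d] by (simp add: ennreal_leI flip: ennreal_mult')
    then show ?thesis using False by (simp add: r_def gauge_value_def d_def add_increasing2)
  qed
  have "(\<Sum>i. ennreal (f (r i))) \<le> (\<Sum>i. ennreal (2 ^ k) * gauge_value f (diameter (U i)) + ennreal ((1/2) ^ i))"
    by (intro suminf_le fr) auto
  also have "\<dots> = ennreal (2 ^ k) * (\<Sum>i. gauge_value f (diameter (U i))) + (\<Sum>i. ennreal ((1/2) ^ i))"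
    by (subst suminf_add[symmetric]) (auto simp: ennreal_suminf_cmult)
  also have "(\<Sum>i. ennreal ((1/2) ^ i)) = ennreal 2"
    by (subst suminf_ennreal2) (auto simp: suminf_geometric summable_geometric)
  also have "ennreal (2 ^ k) * (\<Sum>i. gauge_value f (diameter (U i))) + ennreal 2 \<le>
      ennreal (2 ^ k) * ennreal (S + 1) + ennreal 2"
    using U(4) by (intro add_mono mult_left_mono) auto
  also have "\<dots> = ennreal B"
    unfolding B_def using S by (subst ennreal_mult'[symmetric], simp, subst ennreal_plus[symmetric], auto)
  finally have sum_le: "(\<Sum>i. ennreal (f (r i))) \<le> ennreal B" .
  show ?thesis
  proof
    show "0 < r i" "r i \<le> 1" for i using r_pos r_le[of i] r0 by auto
    show "(\<Sum>i. ennreal (f (r i))) < \<infinity>" using sum_le by (auto intro: le_less_trans)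
    show "M \<subseteq> (\<Union>i. ball (u i) (r i))"
    proof
      fix x assume "x \<in> M"
      then obtain i where x: "x \<in> U i" using U(1) by blast
      then have "u i \<in> U i" unfolding u_def by (rule someI)
      then have "dist (u i) x \<le> diameter (U i)" using x U(2) diameter_bounded_bound by blast
      also have "\<dots> < r i" using diam_nn[of i] r_pos[of i] by (auto simp: r_def)
      finally show "x \<in> (\<Union>i. ball (u i) (r i))" by auto
    qed
    have "emeasure lborel (\<Union>i. ball (u i) (r i)) \<le> (\<Sum>i. emeasure lborel (ball (u i) (r i)))"
      by (rule emeasure_subadditive_countably) auto
    also have "\<dots> \<le> (\<Sum>i. ennreal (V / K) * ennreal (f (r i)))"
    proof (rule suminf_le)
      fix i
      have "V * r i ^ k \<le> V / K * f (r i)"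
        using mult_left_mono[OF fK[OF r_pos[of i] r_le[of i]], of "V / K"] V K by simp
      then show "emeasure lborel (ball (u i) (r i)) \<le> ennreal (V / K) * ennreal (f (r i))"
        using V K r_pos[of i] f_pos[OF r_pos[of i]]
        by (simp add: emeasure_ball V_def k_def ennreal_leI less_imp_le flip: ennreal_mult')
    qed auto
    also have "\<dots> = ennreal (V / K) * (\<Sum>i. ennreal (f (r i)))" by (rule ennreal_suminf_cmult)
    also have "\<dots> \<le> ennreal (V / K) * ennreal B" by (intro mult_left_mono sum_le) simp
    also have "\<dots> = ennreal e" using V K B e by (simp add: K_def flip: ennreal_mult')
    finally show "emeasure lborel (\<Union>i. ball (u i) (r i)) \<le> ennreal e" .
  qed
qed

section \<open>Slabs around graphs\<close>

text \<open>Width is measured along the coordinate directions in \<open>J\<close>, not orthogonally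
  to the graph, so that the slices in these directions are boxes.\<close>

definition slab :: "'a::euclidean_space set \<Rightarrow> ('a \<Rightarrow> 'a \<Rightarrow> real) \<Rightarrow> real \<Rightarrow> 'a set" where
  "slab J h r = {x. \<forall>b\<in>J. \<bar>x \<bullet> b - h b x\<bar> < r}"

text \<open>In particular \<open>h b x\<close> depends only on the coordinates of \<open>x\<close> outside \<open>J\<close>.\<close>

definition graph_over :: "'a::euclidean_space set \<Rightarrow> ('a \<Rightarrow> 'a \<Rightarrow> real) \<Rightarrow> bool" where
  "graph_over J h \<longleftrightarrow> J \<subseteq> Basis \<and>
     (\<forall>b\<in>J. \<forall>x x'. \<bar>h b x - h b x'\<bar> \<le> (\<Sum>c\<in>Basis - J. \<bar>(x - x') \<bullet> c\<bar>))"

lemma graph_over_continuous: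
  assumes "graph_over J h" "b \<in> J"
  shows "continuous_on UNIV (h b)"
  unfolding continuous_on_def
proof
  fix x :: 'a
  have "((\<lambda>z. \<Sum>c\<in>Basis - J. \<bar>(z - x) \<bullet> c\<bar>) \<longlongrightarrow> (\<Sum>c\<in>Basis - J. \<bar>(x - x) \<bullet> c\<bar>)) (at x)"
    by (intro tendsto_intros)
  then have "((\<lambda>z. \<Sum>c\<in>Basis - J. \<bar>(z - x) \<bullet> c\<bar>) \<longlongrightarrow> 0) (at x)" by simp
  then have "((\<lambda>z. \<bar>h b z - h b x\<bar>) \<longlongrightarrow> 0) (at x)"
    by (rule Lim_null_comparison[rotated]) (use assms in \<open>auto simp: graph_over_def\<close>)
  then show "(h b \<longlongrightarrow> h b x) (at x)"
    using Lim_null tendsto_rabs_zero_iff by blast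
qed

lemma open_slab:
  assumes "graph_over J h"
  shows "open (slab J h r)"
proof -
  have "finite J" using assms finite_subset[OF _ finite_Basis] by (auto simp: graph_over_def)
  moreover have "slab J h r = (\<Inter>b\<in>J. {x. \<bar>x \<bullet> b - h b x\<bar> < r})" by (auto simp: slab_def)
  moreover have "open {x. \<bar>x \<bullet> b - h b x\<bar> < r}" if "b \<in> J" for b
    using graph_over_continuous[OF assms that]
    by (intro open_Collect_less continuous_intros)
  ultimately show ?thesis by auto
qed

lemma open_cylinder:
  fixes a :: "'a::euclidean_space"
  shows "open {x. \<forall>b\<in>Basis - J. \<bar>(x - a) \<bullet> b\<bar> < s}"
proof -
  have "{x. \<forall>b\<in>Basis - J. \<bar>(x - a) \<bullet> b\<bar> < s} = (\<Inter>b\<in>Basis - J. {x. \<bar>(x - a) \<bullet> b\<bar> < s})" by auto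
  moreover have "open {x. \<bar>(x - a) \<bullet> b\<bar> < s}" for b
    by (intro open_Collect_less continuous_intros)
  ultimately show ?thesis by auto
qed

text \<open>By Fubini: with the coordinates outside \<open>J\<close> fixed, \<open>h\<close> is
  constant, so the slice is a box of side \<open>2 * t\<close> wherever it is centred. The slab is a
  shear of a product of boxes.\<close>

lemma emeasure_slab:
  fixes a :: "'a::euclidean_space"
  assumes g: "graph_over J h" and "0 \<le> s" "0 \<le> t"
  shows "emeasure lborel ({x. \<forall>b\<in>Basis - J. \<bar>(x - a) \<bullet> b\<bar> < s} \<inter> slab J h t) =
     ennreal ((2 * s) ^ (DIM('a) - card J) * (2 * t) ^ card J)"
proof -
  interpret product_sigma_finite "\<lambda>_::'a. lborel :: real measure" ..
  define I where "I = Basis - J"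
  have J: "J \<subseteq> Basis" using g by (simp add: graph_over_def)
  have fin[simp]: "finite I" "finite J" using J finite_subset[OF _ finite_Basis] by (auto simp: I_def)
  have IJ: "I \<inter> J = {}" "I \<union> J = Basis" using J by (auto simp: I_def)
  have card_I: "card I = DIM('a) - card J" using J by (simp add: I_def card_Diff_subset)
  define S where "S = {x. \<forall>b\<in>Basis - J. \<bar>(x - a) \<bullet> b\<bar> < s} \<inter> slab J h t"
  have S[measurable]: "S \<in> sets borel"
    using open_slab[OF g] open_cylinder[of J a s] by (auto simp: S_def)
  define X where "X f = (\<Sum>b\<in>Basis. f b *\<^sub>R b)" for f :: "'a \<Rightarrow> real"
  have X_inner: "X f \<bullet> b = f b" if "b \<in> Basis" for f b using that by (simp add: X_def)
  have X[measurable]: "X \<in> measurable (PiM Basis (\<lambda>_. lborel)) borel" unfolding X_def by measurable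
  define A where "A = (\<lambda>b::'a. {a \<bullet> b - s <..< a \<bullet> b + s})"
  \<comment> \<open>Here \<open>x\<close> only carries coordinates in \<open>I\<close>;
    \<open>X x\<close> takes unspecified values in the directions of \<open>J\<close>, to which
    \<open>h\<close> is insensitive.\<close>
  define B where "B x = (\<lambda>b. {h b (X x) - t <..< h b (X x) + t})" for x
  have split: "indicator S (X (merge I J (x, y))) = (indicator (Pi\<^sub>E I A) x * indicator (Pi\<^sub>E J (B x)) y :: ennreal)"
    if "x \<in> space (PiM I (\<lambda>_. lborel))" "y \<in> space (PiM J (\<lambda>_. lborel))" for x y
  proof -
    let ?z = "X (merge I J (x, y))"
    have h: "h b ?z = h b (X x)" if "b \<in> J" for b
    proof -
      have "(\<Sum>c\<in>Basis - J. \<bar>(?z - X x) \<bullet> c\<bar>) = 0"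
        by (rule sum.neutral) (use IJ in \<open>auto simp: inner_diff_left X_inner merge_def I_def\<close>)
      then show ?thesis using g that unfolding graph_over_def by (metis abs_le_zero_iff eq_iff_diff_eq_0)
    qed
    have zI: "?z \<bullet> b = x b" if "b \<in> I" for b using that IJ by (auto simp: X_inner merge_def I_def)
    have zJ: "?z \<bullet> b = y b" if "b \<in> J" for b using that IJ J by (auto simp: X_inner merge_def I_def)
    have "?z \<in> S \<longleftrightarrow> (\<forall>b\<in>I. \<bar>x b - a \<bullet> b\<bar> < s) \<and> (\<forall>b\<in>J. \<bar>y b - h b (X x)\<bar> < t)"
      unfolding S_def slab_def I_def[symmetric] by (auto simp: inner_diff_left zI zJ h)
    also have "\<dots> \<longleftrightarrow> x \<in> Pi\<^sub>E I A \<and> y \<in> Pi\<^sub>E J (B x)"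
      using that by (auto simp: PiE_iff space_PiM A_def B_def abs_less_iff)
    finally show ?thesis by (auto simp: indicator_def)
  qed
  have "emeasure lborel S = (\<integral>\<^sup>+x. indicator S x \<partial>lborel)" by simp
  also have "\<dots> = (\<integral>\<^sup>+f. indicator S (X f) \<partial>PiM Basis (\<lambda>_. lborel))"
    by (subst lborel_eq, subst nn_integral_distr) (auto simp: X_def[symmetric])
  also have "\<dots> = (\<integral>\<^sup>+f. indicator S (X f) \<partial>PiM (I \<union> J) (\<lambda>_. lborel))" using IJ by simp
  also have "\<dots> = (\<integral>\<^sup>+x. (\<integral>\<^sup>+y. indicator S (X (merge I J (x, y))) \<partial>PiM J (\<lambda>_. lborel)) \<partial>PiM I (\<lambda>_. lborel))"
    by (rule product_nn_integral_fold) (use IJ in auto)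
  also have "\<dots> = (\<integral>\<^sup>+x. indicator (Pi\<^sub>E I A) x * (\<integral>\<^sup>+y. indicator (Pi\<^sub>E J (B x)) y \<partial>PiM J (\<lambda>_. lborel)) \<partial>PiM I (\<lambda>_. lborel))"
  proof (rule nn_integral_cong)
    fix x :: "'a \<Rightarrow> real" assume x: "x \<in> space (PiM I (\<lambda>_. lborel))"
    have [measurable]: "Pi\<^sub>E J (B x) \<in> sets (PiM J (\<lambda>_. lborel))"
      by (rule sets_PiM_I_finite) (auto simp: B_def)
    show "(\<integral>\<^sup>+y. indicator S (X (merge I J (x, y))) \<partial>PiM J (\<lambda>_. lborel)) =
       indicator (Pi\<^sub>E I A) x * (\<integral>\<^sup>+y. indicator (Pi\<^sub>E J (B x)) y \<partial>PiM J (\<lambda>_. lborel))"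
      by (subst nn_integral_cmult[symmetric]) (auto intro!: nn_integral_cong simp: split[OF x])
  qed
  also have "\<dots> = (\<integral>\<^sup>+x. indicator (Pi\<^sub>E I A) x * ennreal ((2 * t) ^ card J) \<partial>PiM I (\<lambda>_. lborel))"
  proof (rule nn_integral_cong)
    fix x :: "'a \<Rightarrow> real"
    have m: "Pi\<^sub>E J (B x) \<in> sets (PiM J (\<lambda>_. lborel))"
      by (rule sets_PiM_I_finite) (auto simp: B_def)
    have "emeasure (PiM J (\<lambda>_. lborel)) (Pi\<^sub>E J (B x)) = (\<Prod>b\<in>J. emeasure lborel (B x b))"
      by (rule emeasure_PiM) (auto simp: B_def)
    also have "\<dots> = (\<Prod>b\<in>J. ennreal (2 * t))"
      using assms by (intro prod.cong) (auto simp: B_def)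
    also have "\<dots> = ennreal ((2 * t) ^ card J)" using assms by (simp add: ennreal_power)
    finally show "indicator (Pi\<^sub>E I A) x * (\<integral>\<^sup>+y. indicator (Pi\<^sub>E J (B x)) y \<partial>PiM J (\<lambda>_. lborel)) =
       indicator (Pi\<^sub>E I A) x * ennreal ((2 * t) ^ card J)" using m by simp
  qed
  also have "\<dots> = emeasure (PiM I (\<lambda>_. lborel)) (Pi\<^sub>E I A) * ennreal ((2 * t) ^ card J)"
    by (subst nn_integral_multc) (auto simp: A_def intro!: sets_PiM_I_finite)
  also have "emeasure (PiM I (\<lambda>_. lborel)) (Pi\<^sub>E I A) = (\<Prod>b\<in>I. emeasure lborel (A b))"
    by (rule emeasure_PiM) (auto simp: A_def)
  also have "\<dots> = (\<Prod>b\<in>I. ennreal (2 * s))"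
    using assms by (intro prod.cong) (auto simp: A_def)
  also have "\<dots> = ennreal ((2 * s) ^ card I)" using assms by (simp add: ennreal_power)
  finally show ?thesis using assms unfolding S_def card_I by (simp flip: ennreal_mult')
qed

lemma emeasure_ball_slab_le:
  fixes u :: "'a::euclidean_space"
  assumes "graph_over J h" "0 \<le> r" "0 \<le> t"
  shows "emeasure lborel (ball u r \<inter> slab J h t) \<le> ennreal ((2 * r) ^ (DIM('a) - card J) * (2 * t) ^ card J)"
proof -
  have "\<bar>(x - u) \<bullet> b\<bar> < r" if "x \<in> ball u r" "b \<in> Basis" for x b
    using that Basis_le_norm[of b "x - u"] by (auto simp: dist_norm norm_minus_commute)
  then have "emeasure lborel (ball u r \<inter> slab J h t) \<le>
      emeasure lborel ({x. \<forall>b\<in>Basis - J. \<bar>(x - u) \<bullet> b\<bar> < r} \<inter> slab J h t)"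
    using open_slab[OF assms(1)] open_cylinder[of J u r] by (intro emeasure_mono) auto
  then show ?thesis using emeasure_slab[OF assms] by simp
qed

text \<open>Within \<open>s\<close> of \<open>x\<close> in the coordinates outside \<open>J\<close>,
  the graph moves by at most \<open>DIM('a) * s\<close>, and leaving one slab and entering the other
  costs \<open>s\<close> each. Summing over \<open>DIM('a)\<close> coordinates bounds the norm, and
  the final 1 makes the inequality strict.\<close>

definition slab_reach :: "'a::euclidean_space itself \<Rightarrow> real" where
  "slab_reach _ = real (DIM('a) * (DIM('a) + 2) + 1)"

lemma slab_reach_pos: "0 < slab_reach TYPE('a::euclidean_space)"
  unfolding slab_reach_def by linarith

text \<open>The narrow slab over the whole cylinder of half-width \<open>s\<close> around
  \<open>x\<close> fits into the ball, so the exact volume formula is a lower bound.\<close>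

lemma emeasure_ball_slab_ge:
  fixes x :: "'a::euclidean_space"
  assumes g: "graph_over J h" and x: "x \<in> slab J h s" and t: "0 \<le> t" "t \<le> s" and s: "0 < s"
  shows "ennreal ((2 * s) ^ (DIM('a) - card J) * (2 * t) ^ card J) \<le>
     emeasure lborel (ball x (slab_reach TYPE('a) * s) \<inter> slab J h t)"
proof -
  have "{z. \<forall>b\<in>Basis - J. \<bar>(z - x) \<bullet> b\<bar> < s} \<inter> slab J h t \<subseteq> ball x (slab_reach TYPE('a) * s)"
  proof clarify
    fix z assume z: "\<forall>b\<in>Basis - J. \<bar>(z - x) \<bullet> b\<bar> < s" "z \<in> slab J h t"
    have "\<bar>(z - x) \<bullet> b\<bar> \<le> (DIM('a) + 2) * s" if b: "b \<in> Basis" for b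
    proof (cases "b \<in> J")
      case True
      have "\<bar>h b z - h b x\<bar> \<le> (\<Sum>c\<in>Basis - J. \<bar>(z - x) \<bullet> c\<bar>)" using g True by (auto simp: graph_over_def)
      also have "\<dots> \<le> (\<Sum>c\<in>Basis - J. s)" using z(1) by (intro sum_mono) (auto intro: less_imp_le)
      also have "\<dots> \<le> (\<Sum>c\<in>(Basis::'a set). s)" using s by (intro sum_mono2) auto
      finally have 1: "\<bar>h b z - h b x\<bar> \<le> DIM('a) * s" by simp
      have 2: "\<bar>x \<bullet> b - h b x\<bar> < s" "\<bar>z \<bullet> b - h b z\<bar> < t" using x z(2) True by (auto simp: slab_def)
      have "\<bar>(z - x) \<bullet> b\<bar> \<le> DIM('a) * s + s + s" using 1 2 t by (simp add: inner_diff_left)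
      then show ?thesis by (simp add: algebra_simps)
    next
      case False
      then have "\<bar>(z - x) \<bullet> b\<bar> < 1 * s" using z b by auto
      also have "\<dots> \<le> (DIM('a) + 2) * s" using s by (intro mult_right_mono) auto
      finally show ?thesis by simp
    qed
    then have "(\<Sum>b\<in>Basis. \<bar>(z - x) \<bullet> b\<bar>) \<le> (\<Sum>b\<in>(Basis::'a set). (DIM('a) + 2) * s)" by (intro sum_mono)
    then have "norm (z - x) \<le> DIM('a) * ((DIM('a) + 2) * s)"
      using norm_le_l1[of "z - x"] by simp
    also have "\<dots> < slab_reach TYPE('a) * s" using s by (simp add: slab_reach_def algebra_simps)
    finally show "z \<in> ball x (slab_reach TYPE('a) * s)" by (simp add: dist_norm norm_minus_commute)
  qed
  then have "emeasure lborel ({z. \<forall>b\<in>Basis - J. \<bar>(z - x) \<bullet> b\<bar> < s} \<inter> slab J h t) \<le>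
     emeasure lborel (ball x (slab_reach TYPE('a) * s) \<inter> slab J h t)"
    using open_slab[OF g] by (intro emeasure_mono) auto
  then show ?thesis using emeasure_slab[OF g, of s t x] s t by simp
qed

section \<open>Limsup sets of slabs\<close>

lemma ball_in_meeting_ball:
  fixes u x :: "'a::euclidean_space"
  assumes meet: "ball u r \<inter> ball x R \<noteq> {}" and R: "0 < R" "R < r"
  obtains c where "ball c R \<subseteq> ball u r \<inter> ball x (3 * R)"
proof -
  obtain p where p: "dist u p < r" "dist x p < R" using meet by auto
  have "\<exists>c. dist u c \<le> r - R \<and> dist p c \<le> R"
  proof (cases "dist u p \<le> r - R")
    case True then show ?thesis using R by (intro exI[of _ p]) auto
  next
    case False
    \<comment> \<open>The point at distance \<open>r - R\<close> from \<open>u\<close> on the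
      segment towards \<open>p\<close>; it is less than \<open>R\<close> away from
      \<open>p\<close>.\<close>
    define c where "c = u + ((r - R) / norm (p - u)) *\<^sub>R (p - u)"
    have n: "r - R < norm (p - u)" "norm (p - u) < r"
      using False p by (auto simp: dist_norm norm_minus_commute)
    have "norm (p - u) \<noteq> 0" using n R by linarith
    then have nz: "p \<noteq> u" by simp
    have "p - c = (1 - (r - R) / norm (p - u)) *\<^sub>R (p - u)" by (simp add: c_def algebra_simps)
    then have "norm (p - c) = \<bar>1 - (r - R) / norm (p - u)\<bar> * norm (p - u)" by simp
    also have "\<bar>1 - (r - R) / norm (p - u)\<bar> = 1 - (r - R) / norm (p - u)"
      using n R by (intro abs_of_nonneg) (simp add: divide_le_eq)
    also have "(1 - (r - R) / norm (p - u)) * norm (p - u) = norm (p - u) - (r - R)"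
      using nz by (simp add: left_diff_distrib[of 1])
    finally have "norm (p - c) \<le> R" using n by simp
    moreover have "norm (u - c) = r - R" using nz n R by (simp add: c_def)
    ultimately show ?thesis by (intro exI[of _ c]) (simp add: dist_norm)
  qed
  then obtain c where c: "dist u c \<le> r - R" "dist p c \<le> R" by blast
  have "ball c R \<subseteq> ball u r \<inter> ball x (3 * R)"
  proof
    fix z assume "z \<in> ball c R"
    then have "dist c z < R" by simp
    then show "z \<in> ball u r \<inter> ball x (3 * R)"
      using c p dist_triangle[of u z c] dist_triangle[of x z c] dist_triangle[of x c p] by auto
  qed
  then show ?thesis by (rule that)
qed

text \<open>The sets \<open>I N\<close> are the tails of the index set, so that a limsup set is an
  intersection over \<open>N\<close> of unions over \<open>I N\<close> without any enumeration of
  the indices. The common codimension of the graphs is \<open>m\<close>; \<open>\<Upsilon>\<close>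
  and \<open>\<Theta>\<close> are the narrow and wide radii to be compared.\<close>

locale shrinking_slabs =
  fixes J :: "'i \<Rightarrow> 'a::euclidean_space set"
    and h :: "'i \<Rightarrow> 'a \<Rightarrow> 'a \<Rightarrow> real"
    and I :: "nat \<Rightarrow> 'i set"
    and \<Upsilon> \<Theta> :: "'i \<Rightarrow> real"
    and m :: nat
  assumes graph: "i \<in> I N \<Longrightarrow> graph_over (J i) (h i)"
    and card_J: "i \<in> I N \<Longrightarrow> card (J i) = m"
    and decreasing: "N \<le> N' \<Longrightarrow> I N' \<subseteq> I N"
    and Upsilon_pos: "i \<in> I N \<Longrightarrow> 0 < \<Upsilon> i"
    and Theta_pos: "i \<in> I N \<Longrightarrow> 0 < \<Theta> i"
    and small: "0 < \<epsilon> \<Longrightarrow> \<exists>N. \<forall>i\<in>I N. \<Upsilon> i < \<epsilon> \<and> \<Theta> i < \<epsilon>"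
begin

definition level :: "('i \<Rightarrow> real) \<Rightarrow> nat \<Rightarrow> 'a set" where
  "level r N = (\<Union>i\<in>I N. slab (J i) (h i) (r i))"

definition limsup_slabs :: "('i \<Rightarrow> real) \<Rightarrow> 'a set" where
  "limsup_slabs r = (\<Inter>N. level r N)"

lemma open_level: "open (level r N)"
  unfolding level_def using open_slab graph by blast

lemma card_le_DIM: "i \<in> I N \<Longrightarrow> m \<le> DIM('a)"
  using card_J graph by (metis card_mono finite_Basis graph_over_def)

lemma limsup_slabs_small:
  assumes x: "x \<in> limsup_slabs \<Theta>" and e: "0 < \<epsilon>"
  obtains i where "i \<in> I N" "\<Upsilon> i < \<epsilon>" "\<Theta> i < \<epsilon>" "x \<in> slab (J i) (h i) (\<Theta> i)"
proof -
  obtain N' where N': "\<forall>i\<in>I N'. \<Upsilon> i < \<epsilon> \<and> \<Theta> i < \<epsilon>" using small[OF e] by blast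
  have "x \<in> level \<Theta> (max N N')" using x by (auto simp: limsup_slabs_def)
  then obtain i where "i \<in> I (max N N')" "x \<in> slab (J i) (h i) (\<Theta> i)" by (auto simp: level_def)
  moreover have "I (max N N') \<subseteq> I N" "I (max N N') \<subseteq> I N'" using decreasing by auto
  ultimately show ?thesis using N' that by blast
qed

text \<open>A point of infinitely many \<open>\<Theta>\<close>-slabs has arbitrarily small balls in
  which a \<open>\<Upsilon>\<close>-slab, hence the open set \<open>level \<Upsilon> N\<close>,
  fills a fixed proportion. Outside that level only a negligible set of points can have this
  property; then the exceptional sets are united over \<open>N\<close>.\<close>

lemma negligible_limsup_comparable:
  assumes K: "1 \<le> K" and le: "\<And>i. i \<in> I 0 \<Longrightarrow> \<Theta> i \<le> K * \<Upsilon> i"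
    and G: "open G" "bounded G" and full: "negligible (G - limsup_slabs \<Theta>)"
  shows "negligible (G - limsup_slabs \<Upsilon>)"
proof -
  have "negligible (G - level \<Upsilon> N)" for N
  proof -
    define W where "W = level \<Upsilon> N \<inter> G"
    have W: "open W" "bounded W" using G open_level by (auto simp: W_def intro: bounded_subset)
    define w :: "'a \<Rightarrow> ennreal" where "w = indicator W"
    have meas: "w \<in> borel_measurable borel" using W by (simp add: w_def)
    have "(\<integral>\<^sup>+x. w x \<partial>lborel) < \<infinity>"
      using W emeasure_bounded_finite[of W] by (simp add: w_def)
    note negl = negligible_zero_of_high_density[OF meas this]
    let ?E = "{x. w x = 0 \<and> (\<exists>\<eta>>0. \<forall>d>0. \<exists>\<rho>. 0 < \<rho> \<and> \<rho> < d \<and>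
            ennreal (\<eta> * \<rho> ^ DIM('a)) < (\<integral>\<^sup>+z\<in>ball x \<rho>. w z \<partial>lborel))}"
    have "x \<in> ?E" if x: "x \<in> G" "x \<notin> level \<Upsilon> N" "x \<in> limsup_slabs \<Theta>" for x
    proof (rule CollectI, intro conjI)
      show "w x = 0" using x by (simp add: w_def W_def)
      define C where "C = slab_reach TYPE('a)"
      have C: "0 < C" using slab_reach_pos by (simp add: C_def)
      \<comment> \<open>Half of the guaranteed proportion, so that the comparison below is
        strict.\<close>
      define \<eta> where "\<eta> = 2 ^ DIM('a) / (2 * K ^ m * C ^ DIM('a))"
      have eta: "0 < \<eta>" using C K by (simp add: \<eta>_def)
      obtain e where e: "0 < e" "ball x e \<subseteq> G" using G(1) x(1) by (rule openE)
      have "\<exists>\<rho>>0. \<rho> < d \<and> ennreal (\<eta> * \<rho> ^ DIM('a)) < (\<integral>\<^sup>+z\<in>ball x \<rho>. w z \<partial>lborel)" if d: "0 < d" for d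
      proof -
        have "0 < min d e / C" using d e(1) C by simp
        then obtain i where i: "i \<in> I N" "\<Upsilon> i < min d e / C" "\<Theta> i < min d e / C" "x \<in> slab (J i) (h i) (\<Theta> i)"
          using limsup_slabs_small[OF x(3)] by metis
        \<comment> \<open>The maximum, because the lower bound for volumes requires the narrow
          radius not to exceed the wide one, and either radius may be the larger here.\<close>
        define s where "s = max (\<Theta> i) (\<Upsilon> i)"
        have pos: "0 < \<Upsilon> i" "0 < \<Theta> i" using Upsilon_pos Theta_pos i by auto
        have i0: "i \<in> I 0" using i(1) decreasing by blast
        have s: "0 < s" "\<Upsilon> i \<le> s" "s \<le> K * \<Upsilon> i"
          using pos le[OF i0] mult_right_mono[OF K, of "\<Upsilon> i"] by (auto simp: s_def)
        have xs: "x \<in> slab (J i) (h i) s" using i(4) by (auto simp: slab_def s_def)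
        have Cs: "0 < C * s" "C * s < d" "C * s < e" using i(2,3) C s(1) by (auto simp: s_def field_simps max_def)
        have mk: "m \<le> DIM('a)" by (rule card_le_DIM[OF i(1)])
        have "\<eta> * (C * s) ^ DIM('a) = (2 * s) ^ DIM('a) / K ^ m / 2"
          using C by (simp add: \<eta>_def power_mult_distrib)
        also have "\<dots> < (2 * s) ^ DIM('a) / K ^ m"
        proof -
          have half: "z / 2 < z" if "0 < z" for z :: real using that by simp
          have "0 < (2 * s) ^ DIM('a) / K ^ m" using s(1) K by simp
          then show ?thesis by (rule half)
        qed
        also have "\<dots> = (2 * s) ^ (DIM('a) - m) * ((2 * s) ^ m / K ^ m)"
          using mk by (simp only: times_divide_eq_right power_add[symmetric] le_add_diff_inverse2)
        also have "\<dots> \<le> (2 * s) ^ (DIM('a) - m) * (2 * \<Upsilon> i) ^ m"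
        proof (rule mult_left_mono)
          have "(2 * s) ^ m \<le> (2 * (K * \<Upsilon> i)) ^ m" using s by (intro power_mono) auto
          then show "(2 * s) ^ m / K ^ m \<le> (2 * \<Upsilon> i) ^ m"
            using K by (simp add: field_simps power_mult_distrib)
        qed (use s in simp)
        finally have lt: "\<eta> * (C * s) ^ DIM('a) < (2 * s) ^ (DIM('a) - m) * (2 * \<Upsilon> i) ^ m" .
        have "ennreal (\<eta> * (C * s) ^ DIM('a)) < ennreal ((2 * s) ^ (DIM('a) - m) * (2 * \<Upsilon> i) ^ m)"
          using lt eta Cs(1) s(1) pos(1) by (intro ennreal_lessI) auto
        also have "\<dots> \<le> emeasure lborel (ball x (C * s) \<inter> slab (J i) (h i) (\<Upsilon> i))"
          using emeasure_ball_slab_ge[OF graph[OF i(1)] xs, of "\<Upsilon> i"] pos s card_J[OF i(1)] by (simp add: C_def)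
        also have "\<dots> \<le> emeasure lborel (W \<inter> ball x (C * s))"
        proof (rule emeasure_mono)
          have "ball x (C * s) \<subseteq> G" using e Cs(3) subset_ball[of "C * s" e x] by auto
          then show "ball x (C * s) \<inter> slab (J i) (h i) (\<Upsilon> i) \<subseteq> W \<inter> ball x (C * s)"
            using i(1) by (auto simp: W_def level_def)
        qed (use W in auto)
        also have "\<dots> = (\<integral>\<^sup>+z\<in>ball x (C * s). w z \<partial>lborel)"
          using W by (simp add: w_def flip: indicator_inter_arith)
        finally show ?thesis using Cs by blast
      qed
      then show "\<exists>\<eta>>0. \<forall>d>0. \<exists>\<rho>>0. \<rho> < d \<and> ennreal (\<eta> * \<rho> ^ DIM('a)) < (\<integral>\<^sup>+z\<in>ball x \<rho>. w z \<partial>lborel)"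
        using eta by blast
    qed
    then have "G - level \<Upsilon> N \<subseteq> (G - limsup_slabs \<Theta>) \<union> ?E" by blast
    then show ?thesis using negligible_Un[OF full negl] by (rule negligible_subset[rotated])
  qed
  then have "negligible (\<Union>N. G - level \<Upsilon> N)" by (intro negligible_countable_Union) auto
  then show ?thesis by (rule negligible_subset) (auto simp: limsup_slabs_def)
qed

end

text \<open>The two monotonicity assumptions say, free of division, that
  \<open>f r / r ^ DIM('a)\<close> decreases and that \<open>g r = f r / r ^ (DIM('a) - m)\<close>
  increases; \<open>Theta_eq\<close> says that \<open>\<Theta> i ^ m\<close> equals
  \<open>g (\<Upsilon> i)\<close>.\<close>

locale mass_transference = shrinking_slabs J h I \<Upsilon> \<Theta> m
  for J :: "'i \<Rightarrow> 'a::euclidean_space set" and h I \<Upsilon> \<Theta> m +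
  fixes f :: "real \<Rightarrow> real"
  assumes f_pos: "0 < r \<Longrightarrow> 0 < f r"
    and antimono_volume: "0 < r \<Longrightarrow> r \<le> s \<Longrightarrow> f s * r ^ DIM('a) \<le> f r * s ^ DIM('a)"
    and mono_codim: "0 < r \<Longrightarrow> r \<le> s \<Longrightarrow> f r * s ^ (DIM('a) - m) \<le> f s * r ^ (DIM('a) - m)"
    and Theta_eq: "i \<in> I N \<Longrightarrow> \<Theta> i ^ m * \<Upsilon> i ^ (DIM('a) - m) = f (\<Upsilon> i)"
    and Upsilon_le_Theta: "\<exists>N. \<forall>i\<in>I N. \<Upsilon> i \<le> \<Theta> i"
begin

text \<open>The slab captures volume at most proportional to the gauge of the ball, with a factor
  independent of the ball. Large balls use the slab volume and \<open>mono_codim\<close>; balls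
  smaller than the slab width use their full volume and \<open>antimono_volume\<close>.\<close>

lemma emeasure_ball_slab_le_gauge:
  assumes i: "i \<in> I N" and r: "0 < r"
  shows "emeasure lborel (ball u r \<inter> slab (J i) (h i) (\<Upsilon> i)) \<le>
    ennreal ((2 * \<Upsilon> i) ^ DIM('a) / f (\<Upsilon> i) * f r)"
proof -
  have U: "0 < \<Upsilon> i" using Upsilon_pos i by auto
  have fU: "0 < f (\<Upsilon> i)" using f_pos U by auto
  let ?k = "DIM('a)"
  have mk: "m \<le> ?k" by (rule card_le_DIM[OF i])
  show ?thesis
  proof (cases "\<Upsilon> i \<le> r")
    case True
    have "emeasure lborel (ball u r \<inter> slab (J i) (h i) (\<Upsilon> i)) \<le> ennreal ((2 * r) ^ (?k - m) * (2 * \<Upsilon> i) ^ m)"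
      using emeasure_ball_slab_le[OF graph[OF i], of r "\<Upsilon> i" u] r U card_J[OF i] by simp
    also have "(2 * r) ^ (?k - m) * (2 * \<Upsilon> i) ^ m \<le> (2 * \<Upsilon> i) ^ ?k / f (\<Upsilon> i) * f r"
    proof -
      have "(2 * r) ^ (?k - m) * (2 * \<Upsilon> i) ^ m * f (\<Upsilon> i) =
          2 ^ (?k - m) * (2 * \<Upsilon> i) ^ m * (f (\<Upsilon> i) * r ^ (?k - m))"
        by (simp add: power_mult_distrib)
      also have "\<dots> \<le> 2 ^ (?k - m) * (2 * \<Upsilon> i) ^ m * (f r * \<Upsilon> i ^ (?k - m))"
        using mono_codim[OF U True] U by (intro mult_left_mono) auto
      also have "\<dots> = ((2 * \<Upsilon> i) ^ m * (2 * \<Upsilon> i) ^ (?k - m)) * f r" by (simp add: power_mult_distrib)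
      also have "(2 * \<Upsilon> i) ^ m * (2 * \<Upsilon> i) ^ (?k - m) = (2 * \<Upsilon> i) ^ ?k"
        using mk by (simp only: power_add[symmetric] le_add_diff_inverse)
      finally show ?thesis using fU by (simp add: field_simps)
    qed
    finally show ?thesis by (auto simp: ennreal_leI)
  next
    case False
    then have le: "r \<le> \<Upsilon> i" by simp
    \<comment> \<open>With no constrained directions the slab is the whole space, so the slab
      estimate bounds the volume of the ball by that of a cube.\<close>
    have g: "graph_over ({}::'a set) (\<lambda>_ _. 0)" by (simp add: graph_over_def)
    have "emeasure lborel (ball u r \<inter> slab (J i) (h i) (\<Upsilon> i)) \<le> emeasure lborel (ball u r \<inter> slab {} (\<lambda>_ _. 0) 1)"
      by (rule emeasure_mono) (auto simp: slab_def)
    also have "\<dots> \<le> ennreal ((2 * r) ^ ?k)"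
      using emeasure_ball_slab_le[OF g, of r 1 u] r by simp
    also have "(2 * r) ^ ?k \<le> (2 * \<Upsilon> i) ^ ?k / f (\<Upsilon> i) * f r"
    proof -
      have "(2 * r) ^ ?k * f (\<Upsilon> i) = 2 ^ ?k * (f (\<Upsilon> i) * r ^ ?k)" by (simp add: power_mult_distrib)
      also have "\<dots> \<le> 2 ^ ?k * (f r * \<Upsilon> i ^ ?k)"
        using antimono_volume[OF r le] by (intro mult_left_mono) auto
      also have "\<dots> = (2 * \<Upsilon> i) ^ ?k * f r" by (simp add: power_mult_distrib)
      finally show ?thesis using fU by (simp add: field_simps)
    qed
    finally show ?thesis by (auto simp: ennreal_leI)
  qed
qed

text \<open>Spread the mass \<open>f (r j)\<close> evenly over the \<open>j\<close>-th ball. At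
  almost every point outside \<open>W\<close> the mass of small balls is negligible against their
  volume. If \<open>W\<close> covered almost all of the narrow slab near such a point
  \<open>x\<close> of a wide slab, the captured volumes would have to add up to the volume of that
  piece, but the nearby mass allows only half of it.\<close>

lemma level_outside_balls_not_negligible:
  fixes u :: "nat \<Rightarrow> 'a" and r :: "nat \<Rightarrow> real"
  assumes r: "\<And>j. 0 < r j" "\<And>j. r j \<le> 1" and sum: "(\<Sum>j. ennreal (f (r j))) < \<infinity>"
    and W: "W = (\<Union>j. ball (u j) (r j))"
    and G: "open G" "\<not> negligible (G - W)" and full: "negligible (G - limsup_slabs \<Theta>)"
  shows "\<not> negligible (G \<inter> level \<Upsilon> N - W)"
proof
  assume null: "negligible (G \<inter> level \<Upsilon> N - W)"
  define k where "k = DIM('a)"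
  define V where "V = unit_ball_vol (real DIM('a))"
  have V: "0 < V" by (simp add: V_def)
  have vol: "emeasure lborel (ball c s) = ennreal (V * s ^ k)" if "0 \<le> s" for c :: 'a and s
    using that by (simp add: emeasure_ball V_def k_def)
  have fr: "0 < f (r j)" for j using f_pos r by auto
  define w where "w j x = ennreal (f (r j) / (V * r j ^ k)) * indicator (ball (u j) (r j)) x" for j x
  have w_meas [measurable]: "w j \<in> borel_measurable borel" for j unfolding w_def
    by (intro borel_measurable_times_ennreal borel_measurable_const borel_measurable_indicator) auto
  have w_int: "(\<integral>\<^sup>+x\<in>S. w j x \<partial>lborel) = ennreal (f (r j) / (V * r j ^ k)) * emeasure lborel (ball (u j) (r j) \<inter> S)"
    if S: "S \<in> sets borel" for S j
  proof -
    have "(\<integral>\<^sup>+x\<in>S. w j x \<partial>lborel) =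
       (\<integral>\<^sup>+x. ennreal (f (r j) / (V * r j ^ k)) * indicator (ball (u j) (r j) \<inter> S) x \<partial>lborel)"
      by (intro nn_integral_cong) (simp add: w_def indicator_def)
    also have "\<dots> = ennreal (f (r j) / (V * r j ^ k)) * emeasure lborel (ball (u j) (r j) \<inter> S)"
      using S by (intro nn_integral_cmult_indicator) auto
    finally show ?thesis .
  qed
  have w_full: "(\<integral>\<^sup>+x\<in>S. w j x \<partial>lborel) = ennreal (f (r j))"
    if S: "S \<in> sets borel" "ball (u j) (r j) \<subseteq> S" for S j
    using V r(1)[of j] fr[of j] S by (simp add: w_int vol Int_absorb2 less_imp_le flip: ennreal_mult')
  define ww where "ww x = (\<Sum>j. w j x)" for x
  have ww_meas: "ww \<in> borel_measurable borel" unfolding ww_def by measurable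
  have ww_int: "(\<integral>\<^sup>+x\<in>S. ww x \<partial>lborel) = (\<Sum>j. \<integral>\<^sup>+x\<in>S. w j x \<partial>lborel)" if [measurable]: "S \<in> sets borel" for S
    unfolding ww_def by (subst nn_integral_suminf[symmetric]) auto
  have "(\<integral>\<^sup>+x. ww x \<partial>lborel) < \<infinity>"
    using ww_int[of UNIV] sum w_full[of UNIV] by simp
  note negl = negligible_zero_of_high_density[OF ww_meas this]
  let ?E = "{x. ww x = 0 \<and> (\<exists>\<eta>>0. \<forall>d>0. \<exists>\<rho>. 0 < \<rho> \<and> \<rho> < d \<and>
            ennreal (\<eta> * \<rho> ^ DIM('a)) < (\<integral>\<^sup>+z\<in>ball x \<rho>. ww z \<partial>lborel))}"
  have "\<not> G - W \<subseteq> (G - limsup_slabs \<Theta>) \<union> ?E"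
    using G(2) negligible_Un[OF full negl] negligible_subset by blast
  then obtain x where x: "x \<in> G" "x \<notin> W" "x \<in> limsup_slabs \<Theta>" "x \<notin> ?E" by blast
  have "ww x = 0" using x(2) by (auto simp: ww_def w_def W)
  have dens: "\<exists>d>0. \<forall>\<rho>. 0 < \<rho> \<longrightarrow> \<rho> < d \<longrightarrow> (\<integral>\<^sup>+z\<in>ball x \<rho>. ww z \<partial>lborel) \<le> ennreal (\<eta> * \<rho> ^ k)"
    if eta: "0 < \<eta>" for \<eta>
  proof (rule ccontr)
    assume "\<not> ?thesis"
    then have "\<forall>d>0. \<exists>\<rho>. 0 < \<rho> \<and> \<rho> < d \<and> ennreal (\<eta> * \<rho> ^ DIM('a)) < (\<integral>\<^sup>+z\<in>ball x \<rho>. ww z \<partial>lborel)"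
      unfolding k_def by (meson not_le)
    then have "x \<in> ?E" using eta \<open>ww x = 0\<close> by blast
    then show False using x(4) by contradiction
  qed
  define C where "C = slab_reach TYPE('a)"
  have C: "1 \<le> C" by (simp add: C_def slab_reach_def)
  \<comment> \<open>The power of \<open>3 * C\<close> turns \<open>(3 * R) ^ k\<close> into
    \<open>\<Theta> i ^ k\<close>. The bound by \<open>f 1\<close> excludes large balls in
    \<open>r_le\<close>, and the bound by 1 together with the factor 1/2 gives the final
    contradiction.\<close>
  define \<eta> where "\<eta> = min (f 1) 1 / (2 * (3 * C) ^ k)"
  have f1: "0 < f 1" using f_pos by simp
  have eta: "0 < \<eta>" using C f1 by (simp add: \<eta>_def)
  obtain d where d: "0 < d" "\<And>\<rho>. 0 < \<rho> \<Longrightarrow> \<rho> < d \<Longrightarrow> (\<integral>\<^sup>+z\<in>ball x \<rho>. ww z \<partial>lborel) \<le> ennreal (\<eta> * \<rho> ^ k)"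
    using dens[OF eta] by blast
  obtain e where e: "0 < e" "ball x e \<subseteq> G" using G(1) x(1) by (rule openE)
  obtain N1 where N1: "\<forall>i\<in>I N1. \<Upsilon> i \<le> \<Theta> i" using Upsilon_le_Theta by blast
  have "0 < min d e / (3 * C)" using d(1) e(1) C by simp
  then obtain i where i: "i \<in> I (max N N1)" "\<Theta> i < min d e / (3 * C)" "x \<in> slab (J i) (h i) (\<Theta> i)"
    using limsup_slabs_small[OF x(3)] by metis
  have iN: "i \<in> I N" and "i \<in> I N1"
    using i(1) decreasing[of N "max N N1"] decreasing[of N1 "max N N1"] by auto
  then have UT: "0 < \<Upsilon> i" "\<Upsilon> i \<le> \<Theta> i" "0 < \<Theta> i" using N1 Upsilon_pos Theta_pos by auto
  define R where "R = C * \<Theta> i"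
  have R: "0 < R" "3 * R < d" "3 * R < e" using i(2) C UT by (auto simp: R_def field_simps)
  have int_le: "(\<integral>\<^sup>+z\<in>ball x (3 * R). ww z \<partial>lborel) \<le> ennreal (\<eta> * (3 * R) ^ k)"
    using R by (intro d(2)) auto
  \<comment> \<open>A larger ball meeting \<open>ball x R\<close> would contain a ball of radius
    \<open>R\<close> inside \<open>ball x (3 * R)\<close>. As its mass density is at least
    \<open>f 1 / V\<close>, it would put too much mass there.\<close>
  have r_le: "r j \<le> R" if meet: "ball (u j) (r j) \<inter> ball x R \<noteq> {}" for j
  proof (rule ccontr)
    assume "\<not> r j \<le> R"
    then obtain c where c: "ball c R \<subseteq> ball (u j) (r j) \<inter> ball x (3 * R)"
      using ball_in_meeting_ball[OF meet R(1)] by auto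
    have f1r: "f 1 * r j ^ k \<le> f (r j)" using antimono_volume[OF r(1)[of j] r(2)[of j]] by (simp add: k_def)
    have "f 1 * R ^ k \<le> f (r j) / (V * r j ^ k) * (V * R ^ k)"
      using mult_right_mono[OF f1r, of "R ^ k"] R(1) V r(1)[of j] by (simp add: field_simps)
    then have "ennreal (f 1 * R ^ k) \<le> ennreal (f (r j) / (V * r j ^ k)) * emeasure lborel (ball c R)"
      using R(1) V r(1)[of j] fr[of j] by (simp add: vol ennreal_leI less_imp_le flip: ennreal_mult')
    also have "\<dots> \<le> ennreal (f (r j) / (V * r j ^ k)) * emeasure lborel (ball (u j) (r j) \<inter> ball x (3 * R))"
      using c by (intro mult_left_mono emeasure_mono) auto
    also have "\<dots> = (\<integral>\<^sup>+z\<in>ball x (3 * R). w j z \<partial>lborel)" by (subst w_int) auto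
    also have "\<dots> \<le> (\<Sum>j. \<integral>\<^sup>+z\<in>ball x (3 * R). w j z \<partial>lborel)"
      using sum_le_suminf[of "\<lambda>j. \<integral>\<^sup>+z\<in>ball x (3 * R). w j z \<partial>lborel" "{j}"] by simp
    also have "\<dots> = (\<integral>\<^sup>+z\<in>ball x (3 * R). ww z \<partial>lborel)" by (subst ww_int) auto
    also have "\<dots> \<le> ennreal (\<eta> * (3 * R) ^ k)" by (rule int_le)
    finally have "f 1 * R ^ k \<le> \<eta> * (3 * R) ^ k" using eta R(1) by (subst (asm) ennreal_le_iff) auto
    then have "f 1 \<le> \<eta> * 3 ^ k" using R(1) by (simp add: power_mult_distrib)
    also have "\<dots> \<le> \<eta> * (3 * C) ^ k" using eta C by (intro mult_left_mono power_mono) auto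
    also have "\<dots> = min (f 1) 1 / 2" using C by (simp add: \<eta>_def)
    also have "\<dots> < f 1" using f1 by auto
    finally show False by simp
  qed
  define T where "T = ball x R \<inter> slab (J i) (h i) (\<Upsilon> i)"
  have T: "open T" using open_slab[OF graph[OF iN]] by (auto simp: T_def)
  define c where "c = (2 * \<Upsilon> i) ^ k / f (\<Upsilon> i)"
  have c: "0 < c" using UT f_pos by (simp add: c_def)
  \<comment> \<open>By \<open>r_le\<close> a ball that meets \<open>T\<close> lies entirely in
    \<open>ball x (3 * R)\<close>, so its full mass \<open>f (r j)\<close> is counted by the
    integral.\<close>
  have term_le: "emeasure lborel (ball (u j) (r j) \<inter> T) \<le> ennreal c * (\<integral>\<^sup>+z\<in>ball x (3 * R). w j z \<partial>lborel)" for j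
  proof (cases "ball (u j) (r j) \<inter> ball x R = {}")
    case True
    then have "ball (u j) (r j) \<inter> T = {}" by (auto simp: T_def)
    then show ?thesis by simp
  next
    case False
    then obtain p where p: "dist (u j) p < r j" "dist x p < R" by auto
    have sub: "ball (u j) (r j) \<subseteq> ball x (3 * R)"
    proof
      fix z assume "z \<in> ball (u j) (r j)"
      then show "z \<in> ball x (3 * R)"
        using p r_le[OF False] dist_triangle[of x z p] dist_triangle[of p z "u j"] by (auto simp: dist_commute)
    qed
    have "emeasure lborel (ball (u j) (r j) \<inter> T) \<le> emeasure lborel (ball (u j) (r j) \<inter> slab (J i) (h i) (\<Upsilon> i))"
      using open_slab[OF graph[OF iN]] by (intro emeasure_mono) (auto simp: T_def)
    also have "\<dots> \<le> ennreal (c * f (r j))"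
      unfolding c_def k_def by (rule emeasure_ball_slab_le_gauge[OF iN r(1)])
    also have "\<dots> = ennreal c * (\<integral>\<^sup>+z\<in>ball x (3 * R). w j z \<partial>lborel)"
      using sub c by (simp add: w_full ennreal_mult')
    finally show ?thesis .
  qed
  have xT: "ball x R \<subseteq> G" using e R subset_ball[of R e x] by auto
  have "T - W \<subseteq> G \<inter> level \<Upsilon> N - W" using xT iN by (auto simp: T_def level_def)
  then have "negligible (T - W)" using null negligible_subset by blast
  moreover have "open W" by (auto simp: W)
  ultimately have "T - W \<in> null_sets lborel"
    using T by (simp add: negligible_iff_null_sets null_sets_completion_iff)
  then have "emeasure lborel T = emeasure lborel (T - (T - W))"
    using T by (intro emeasure_Diff_null_set[symmetric]) auto
  also have "T - (T - W) = (\<Union>j. ball (u j) (r j) \<inter> T)" by (auto simp: W)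
  also have "emeasure lborel \<dots> \<le> (\<Sum>j. emeasure lborel (ball (u j) (r j) \<inter> T))"
    using T by (intro emeasure_subadditive_countably) auto
  also have "\<dots> \<le> (\<Sum>j. ennreal c * (\<integral>\<^sup>+z\<in>ball x (3 * R). w j z \<partial>lborel))"
    by (intro suminf_le term_le) auto
  also have "\<dots> = ennreal c * (\<integral>\<^sup>+z\<in>ball x (3 * R). ww z \<partial>lborel)"
    by (subst ww_int) (auto simp: ennreal_suminf_cmult)
  also have "\<dots> \<le> ennreal c * ennreal (\<eta> * (3 * R) ^ k)" by (intro mult_left_mono int_le) simp
  also have "\<dots> = ennreal (c * (\<eta> * (3 * R) ^ k))" using c by (simp add: ennreal_mult')
  finally have upper: "emeasure lborel T \<le> ennreal (c * (\<eta> * (3 * R) ^ k))" .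
  have mk: "m \<le> k" using card_le_DIM[OF iN] by (simp add: k_def)
  have "ennreal ((2 * \<Theta> i) ^ (k - m) * (2 * \<Upsilon> i) ^ m) \<le> emeasure lborel T"
    using emeasure_ball_slab_ge[OF graph[OF iN] i(3), of "\<Upsilon> i"] UT card_J[OF iN]
    by (simp add: T_def R_def C_def k_def)
  then have "ennreal ((2 * \<Theta> i) ^ (k - m) * (2 * \<Upsilon> i) ^ m) \<le> ennreal (c * (\<eta> * (3 * R) ^ k))"
    using upper by (rule order_trans)
  then have "(2 * \<Theta> i) ^ (k - m) * (2 * \<Upsilon> i) ^ m \<le> c * (\<eta> * (3 * R) ^ k)"
    using c eta R(1) by (subst (asm) ennreal_le_iff) auto
  also have "\<eta> * (3 * R) ^ k = min (f 1) 1 / 2 * \<Theta> i ^ k"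
    using C by (simp add: \<eta>_def R_def power_mult_distrib)
  also have "c * (min (f 1) 1 / 2 * \<Theta> i ^ k) \<le> c * (1 / 2 * \<Theta> i ^ k)"
    using c UT by (intro mult_left_mono mult_right_mono) auto
  \<comment> \<open>By \<open>Theta_eq\<close>, \<open>c * \<Theta> i ^ k\<close> is exactly the
    lower bound for the volume of \<open>T\<close>.\<close>
  also have "c * (1 / 2 * \<Theta> i ^ k) = 1 / 2 * ((2 * \<Theta> i) ^ (k - m) * (2 * \<Upsilon> i) ^ m)"
  proof -
    have split: "z ^ k = z ^ (k - m) * z ^ m" for z :: real using mk by (simp flip: power_add)
    have "c = (2 * \<Upsilon> i) ^ k / (\<Theta> i ^ m * \<Upsilon> i ^ (k - m))"
      using Theta_eq[OF iN] by (simp add: c_def k_def)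
    also have "\<dots> = 2 ^ (k - m) * 2 ^ m * \<Upsilon> i ^ m / \<Theta> i ^ m"
      unfolding split using UT by (simp add: power_mult_distrib)
    finally show ?thesis unfolding split[of "\<Theta> i"] using UT by (simp add: power_mult_distrib)
  qed
  finally have "(2 * \<Theta> i) ^ (k - m) * (2 * \<Upsilon> i) ^ m \<le> 1 / 2 * ((2 * \<Theta> i) ^ (k - m) * (2 * \<Upsilon> i) ^ m)" .
  moreover have "0 < (2 * \<Theta> i) ^ (k - m) * (2 * \<Upsilon> i) ^ m" using UT by simp
  moreover have False if "z \<le> 1 / 2 * z" "0 < z" for z :: real using that by simp
  ultimately show False by blast
qed

text \<open>Baire's theorem on the support of Lebesgue measure on \<open>G - W\<close>: every level
  is relatively open there, and dense by the preceding lemma applied to small open pieces of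
  \<open>G\<close>. The support avoids \<open>W\<close> but may touch the boundary of
  \<open>G\<close>, hence the closure in the conclusion.\<close>

theorem limsup_slabs_not_covered:
  fixes u :: "nat \<Rightarrow> 'a" and r :: "nat \<Rightarrow> real"
  assumes r: "\<And>j. 0 < r j" "\<And>j. r j \<le> 1" and sum: "(\<Sum>j. ennreal (f (r j))) < \<infinity>"
    and W: "W = (\<Union>j. ball (u j) (r j))"
    and G: "open G" "\<not> negligible (G - W)" and full: "negligible (G - limsup_slabs \<Theta>)"
  shows "\<not> closure G \<inter> limsup_slabs \<Upsilon> \<subseteq> W"
proof -
  define S where "S = {x. \<forall>V. open V \<longrightarrow> x \<in> V \<longrightarrow> \<not> negligible (V \<inter> G - W)}"
  have S_D: "\<not> negligible (V \<inter> G - W)" if "x \<in> S" "open V" "x \<in> V" for x V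
    using that unfolding S_def by blast
  have S_I: "\<exists>V. open V \<and> x \<in> V \<and> negligible (V \<inter> G - W)" if "x \<notin> S" for x
    using that unfolding S_def by blast
  have "closed S"
    unfolding closed_def
  proof (subst open_subopen, clarify)
    fix x assume "x \<notin> S"
    then obtain V where V: "open V" "x \<in> V" "negligible (V \<inter> G - W)" using S_I by blast
    then have "V \<subseteq> - S" using S_D by blast
    then show "\<exists>T. open T \<and> x \<in> T \<and> T \<subseteq> - S" using V by blast
  qed
  have S_closure: "S \<subseteq> closure G"
  proof
    fix x assume x: "x \<in> S"
    show "x \<in> closure G"
    proof (rule ccontr)
      assume "x \<notin> closure G"
      then have "\<not> negligible (- closure G \<inter> G - W)" by (intro S_D[OF x]) auto
      moreover have "- closure G \<inter> G - W = {}" using closure_subset by blast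
      ultimately show False by simp
    qed
  qed
  have S_W: "x \<notin> W" if x: "x \<in> S" for x
  proof
    assume "x \<in> W"
    moreover have "open W" by (auto simp: W)
    ultimately have "\<not> negligible (W \<inter> G - W)" by (rule S_D[OF x, rotated])
    moreover have "W \<inter> G - W = {}" by blast
    ultimately show False by simp
  qed
  \<comment> \<open>If \<open>V\<close> missed the support, every point of
    \<open>V \<inter> G - W\<close> would have a negligible neighbourhood in it, and a locally
    negligible set is negligible.\<close>
  have S_meets: "V \<inter> S \<noteq> {}" if V: "open V" "\<not> negligible (V \<inter> G - W)" for V
  proof
    assume empty: "V \<inter> S = {}"
    have "negligible (V \<inter> G - W)"
    proof (subst locally_negligible_alt, intro ballI)
      fix x assume x: "x \<in> V \<inter> G - W"
      then have "x \<notin> S" using empty by blast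
      then obtain V' where V': "open V'" "x \<in> V'" "negligible (V' \<inter> G - W)" using S_I by blast
      show "\<exists>U. openin (top_of_set (V \<inter> G - W)) U \<and> x \<in> U \<and> negligible U"
      proof (intro exI conjI)
        show "openin (top_of_set (V \<inter> G - W)) ((V \<inter> G - W) \<inter> V')" using V'(1) by (rule openin_open_Int)
        show "negligible ((V \<inter> G - W) \<inter> V')" using V'(3) by (rule negligible_subset) auto
      qed (use x V' in auto)
    qed
    then show False using V(2) by simp
  qed
  have "S \<subseteq> closure (\<Inter>(range (\<lambda>N. S \<inter> level \<Upsilon> N)))"
  proof (rule Baire[OF \<open>closed S\<close>])
    fix T assume "T \<in> range (\<lambda>N. S \<inter> level \<Upsilon> N)"
    then obtain N where T: "T = S \<inter> level \<Upsilon> N" by blast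
    have "x \<in> closure T" if x: "x \<in> S" for x
      unfolding closure_iff_nhds_not_empty
    proof (intro allI impI)
      fix A V assume V: "V \<subseteq> A" "open V" "x \<in> V"
      have "\<not> negligible (V \<inter> G - W)" by (rule S_D[OF x V(2,3)])
      moreover have "negligible (V \<inter> G - limsup_slabs \<Theta>)" using full by (rule negligible_subset) auto
      ultimately have "\<not> negligible ((V \<inter> G) \<inter> level \<Upsilon> N - W)"
        using V G(1) by (intro level_outside_balls_not_negligible[OF r sum W]) auto
      moreover have "(V \<inter> G) \<inter> level \<Upsilon> N - W = (V \<inter> level \<Upsilon> N) \<inter> G - W" by blast
      ultimately have "(V \<inter> level \<Upsilon> N) \<inter> S \<noteq> {}"
        using V open_level by (intro S_meets) auto
      then show "T \<inter> A \<noteq> {}" using V(1) T by blast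
    qed
    then show "openin (top_of_set S) T \<and> S \<subseteq> closure T"
      using open_level by (auto simp: T openin_open_Int)
  qed simp
  moreover have "S \<noteq> {}" using S_meets[of UNIV] G(2) by auto
  ultimately have "\<Inter>(range (\<lambda>N. S \<inter> level \<Upsilon> N)) \<noteq> {}" by auto
  then obtain x where "x \<in> S" "\<And>N. x \<in> level \<Upsilon> N" by auto
  then show ?thesis using S_closure S_W unfolding limsup_slabs_def by blast
qed

end

section \<open>Systems of linear forms\<close>

text \<open>Solving for the row with the largest coefficient makes all quotients
  \<open>q $ i / q $ pivot q\<close> at most 1 in absolute value, as the Lipschitz bound in
  \<open>graph_over\<close> demands.\<close>

definition pivot :: "int ^ 'n::finite \<Rightarrow> 'n" where
  "pivot q = (SOME i. nat \<bar>q $ i\<bar> = int_sup_norm q)"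

lemma pivot: "\<bar>q $ pivot q\<bar> = int (int_sup_norm q)"
proof -
  have "int_sup_norm q \<in> range (\<lambda>i. nat \<bar>q $ i\<bar>)"
    unfolding int_sup_norm_def by (rule Max_in) auto
  then have "\<exists>i. nat \<bar>q $ i\<bar> = int_sup_norm q" by auto
  then have "nat \<bar>q $ pivot q\<bar> = int_sup_norm q" unfolding pivot_def by (rule someI_ex)
  then show ?thesis by linarith
qed

lemma abs_component_le_int_sup_norm: "\<bar>q $ i\<bar> \<le> int (int_sup_norm q)"
proof -
  have "nat \<bar>q $ i\<bar> \<le> int_sup_norm q" unfolding int_sup_norm_def by (rule Max_ge) auto
  then show ?thesis by linarith
qed

definition pivot_row :: "int ^ 'n::finite \<Rightarrow> (real ^ 'm::finite ^ 'n) set" where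
  "pivot_row q = range (\<lambda>j. axis (pivot q) (axis j 1))"

text \<open>
  For \<open>b = axis (pivot q) (axis j 1)\<close> this is the value of the entry of \<open>x\<close> in the pivot row and
  column \<open>j\<close> for which column \<open>j\<close> of \<open>q v* x + c\<close> vanishes, the other rows of \<open>x\<close> being given.
\<close>

definition solve_pivot :: "int ^ 'n::finite \<Rightarrow> real ^ 'm::finite \<Rightarrow> real ^ 'm ^ 'n \<Rightarrow> real ^ 'm ^ 'n \<Rightarrow> real" where
  "solve_pivot q c b x =
     - (b $ pivot q \<bullet> (c + (\<Sum>i\<in>UNIV - {pivot q}. real_of_int (q $ i) *\<^sub>R (x $ i)))) / real_of_int (q $ pivot q)"

lemma solve_pivot_axis:
  "solve_pivot q c (axis (pivot q) (axis j 1)) x =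
     - (c $ j + (\<Sum>i\<in>UNIV - {pivot q}. real_of_int (q $ i) * x $ i $ j)) / real_of_int (q $ pivot q)"
  unfolding solve_pivot_def by (simp add: inner_axis' sum_component)

lemma axis_axis_in_Basis: "axis i (axis j (1::real)) \<in> (Basis :: (real ^ 'm::finite ^ 'n::finite) set)"
  by (auto simp: Basis_vec_def)

lemma axis_axis_eq_iff:
  "axis i (axis j (1::real)) = axis i' (axis j' 1) \<longleftrightarrow> i = i' \<and> j = j'"
  by (auto simp: axis_eq_axis)

lemma card_pivot_row: "card (pivot_row q :: (real ^ 'm::finite ^ 'n::finite) set) = CARD('m)"
  unfolding pivot_row_def by (rule card_image) (auto simp: inj_on_def axis_axis_eq_iff)

lemma graph_over_pivot:
  assumes q: "0 < int_sup_norm q"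
  shows "graph_over (pivot_row q :: (real ^ 'm::finite ^ 'n::finite) set) (solve_pivot q c)"
  unfolding graph_over_def
proof (intro conjI ballI allI)
  show "pivot_row q \<subseteq> (Basis :: (real ^ 'm ^ 'n) set)"
    unfolding pivot_row_def using axis_axis_in_Basis by blast
  fix b x x' :: "real ^ 'm ^ 'n"
  assume "b \<in> pivot_row q"
  then obtain j where b: "b = axis (pivot q) (axis j 1)" by (auto simp: pivot_row_def)
  define Q where "Q = real_of_int (q $ pivot q)"
  have Q: "\<bar>Q\<bar> = real (int_sup_norm q)" using pivot[of q] unfolding Q_def by (metis of_int_abs of_int_of_nat_eq)
  define R where "R = UNIV - {pivot q}"
  have "solve_pivot q c b x - solve_pivot q c b x' = (\<Sum>i\<in>R. - (real_of_int (q $ i) / Q) * ((x - x') $ i $ j))"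
    unfolding b solve_pivot_axis Q_def[symmetric] R_def[symmetric]
    by (simp add: diff_divide_distrib[symmetric] sum_subtractf[symmetric] sum_divide_distrib algebra_simps sum_negf)
  also have "\<bar>\<dots>\<bar> \<le> (\<Sum>i\<in>R. \<bar>- (real_of_int (q $ i) / Q) * ((x - x') $ i $ j)\<bar>)" by (rule sum_abs)
  also have "\<dots> \<le> (\<Sum>i\<in>R. \<bar>(x - x') $ i $ j\<bar>)"
  proof (rule sum_mono)
    fix i
    have "\<bar>real_of_int (q $ i)\<bar> \<le> \<bar>Q\<bar>"
      unfolding Q using abs_component_le_int_sup_norm[of q i] by linarith
    then have "\<bar>real_of_int (q $ i)\<bar> / \<bar>Q\<bar> \<le> 1" using q Q by (simp add: divide_le_eq)
    then have "\<bar>real_of_int (q $ i)\<bar> / \<bar>Q\<bar> * \<bar>(x - x') $ i $ j\<bar> \<le> 1 * \<bar>(x - x') $ i $ j\<bar>"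
      by (rule mult_right_mono) simp
    then show "\<bar>- (real_of_int (q $ i) / Q) * ((x - x') $ i $ j)\<bar> \<le> \<bar>(x - x') $ i $ j\<bar>"
      by (simp add: abs_mult)
  qed
  also have "\<dots> = (\<Sum>i\<in>R. \<bar>(x - x') \<bullet> axis i (axis j 1)\<bar>)" by (simp add: inner_axis)
  also have "\<dots> = (\<Sum>d\<in>(\<lambda>i. axis i (axis j 1)) ` R. \<bar>(x - x') \<bullet> d\<bar>)"
    by (subst sum.reindex) (auto simp: inj_on_def axis_axis_eq_iff)
  also have "\<dots> \<le> (\<Sum>d\<in>Basis - pivot_row q. \<bar>(x - x') \<bullet> d\<bar>)"
  proof (rule sum_mono2)
    show "(\<lambda>i. axis i (axis j 1)) ` R \<subseteq> Basis - pivot_row q"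
      using axis_axis_in_Basis by (auto simp: R_def pivot_row_def axis_axis_eq_iff)
  qed auto
  finally show "\<bar>solve_pivot q c b x - solve_pivot q c b x'\<bar> \<le> (\<Sum>d\<in>Basis - pivot_row q. \<bar>(x - x') \<bullet> d\<bar>)" .
qed

lemma infnorm_less_iff:
  fixes z :: "real ^ 'm::finite"
  shows "infnorm z < r \<longleftrightarrow> (\<forall>j. \<bar>z $ j\<bar> < r)"
  unfolding infnorm_Max by (subst Max_less_iff) (auto simp: Basis_vec_def inner_axis)

text \<open>Column \<open>j\<close> of the linear form is \<open>q $ pivot q\<close> times the
  deviation of the pivot entry from its solved value, which accounts for the division of the radius
  by the norm of \<open>q\<close>.\<close>

lemma slab_pivot:
  assumes q: "0 < int_sup_norm q"
  shows "slab (pivot_row q) (solve_pivot q c) (r / real (int_sup_norm q)) =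
     {x :: real ^ 'm::finite ^ 'n::finite. infnorm (real_vec q v* x + c) < r}"
proof (rule set_eqI)
  fix x :: "real ^ 'm ^ 'n"
  define Q where "Q = real_of_int (q $ pivot q)"
  have Q: "\<bar>Q\<bar> = real (int_sup_norm q)" using pivot[of q] unfolding Q_def by (metis of_int_abs of_int_of_nat_eq)
  then have Q0: "Q \<noteq> 0" using q by auto
  have "\<bar>x \<bullet> axis (pivot q) (axis j 1) - solve_pivot q c (axis (pivot q) (axis j 1)) x\<bar> < r / real (int_sup_norm q) \<longleftrightarrow>
      \<bar>(real_vec q v* x + c) $ j\<bar> < r" for j
  proof -
    have "(real_vec q v* x + c) $ j = (\<Sum>i\<in>UNIV. real_of_int (q $ i) * x $ i $ j) + c $ j"
      by (simp add: vector_matrix_mult_def real_vec_def mult.commute)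
    also have "\<dots> = Q * x $ pivot q $ j + (\<Sum>i\<in>UNIV - {pivot q}. real_of_int (q $ i) * x $ i $ j) + c $ j"
      by (subst sum.remove[of _ "pivot q"]) (auto simp: Q_def)
    also have "\<dots> = Q * (x \<bullet> axis (pivot q) (axis j 1) - solve_pivot q c (axis (pivot q) (axis j 1)) x)"
      unfolding solve_pivot_axis Q_def[symmetric] using Q0 by (simp add: inner_axis field_simps)
    finally have "\<bar>(real_vec q v* x + c) $ j\<bar> = real (int_sup_norm q) *
        \<bar>x \<bullet> axis (pivot q) (axis j 1) - solve_pivot q c (axis (pivot q) (axis j 1)) x\<bar>"
      by (simp add: abs_mult Q)
    then show ?thesis using q by (simp add: less_divide_eq mult.commute)
  qed
  then show "x \<in> slab (pivot_row q) (solve_pivot q c) (r / real (int_sup_norm q)) \<longleftrightarrow>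
     x \<in> {x. infnorm (real_vec q v* x + c) < r}"
    by (simp add: slab_def pivot_row_def infnorm_less_iff)
qed

section \<open>Mass transference for systems of linear forms\<close>

theorem theorem7:
  fixes \<psi> \<theta> :: "nat \<Rightarrow> real"
    and f g :: "real \<Rightarrow> real"
    and \<pi> :: "('n::finite + 'm::finite) set set"
    and \<Phi> :: "real ^ 'm ^ 'm"
    and y :: "real ^ 'm"
  assumes psi_pos: "\<And>q. 1 \<le> q \<Longrightarrow> 0 < \<psi> q"
    and psi_lim: "(\<lambda>q. \<psi> q / real q) \<longlonglongrightarrow> 0"
    and partition: "admissible_partition \<pi>"
    and Phi: "\<Phi> \<in> unit_cube" "\<Phi> \<noteq> 0"
    and y: "y \<in> unit_cube"
    and f: "dimension_function f"
    and g_eq: "\<And>r. 0 < r \<Longrightarrow> g r = f r / r ^ (CARD('m) * (CARD('n) - 1))"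
    and g: "dimension_function g"
    and monotonic:
      "mono_on {0<..} (\<lambda>r. f r / r ^ (CARD('n) * CARD('m))) \<or>
       antimono_on {0<..} (\<lambda>r. f r / r ^ (CARD('n) * CARD('m)))"
    and theta_eq:
      "\<And>q. 1 \<le> q \<Longrightarrow> \<theta> q = real q * g (\<psi> q / real q) powr (1 / real CARD('m))"
    and full_measure:
      "emeasure lebesgue (approximable \<pi> y \<Phi> \<theta> :: (real ^ 'm ^ 'n) set) = 1"
  shows "hausdorff_measure f (approximable \<pi> y \<Phi> \<psi> :: (real ^ 'm ^ 'n) set) =
         hausdorff_measure f (unit_cube :: (real ^ 'm ^ 'n) set)"
proof -
  define k where "k = CARD('n) * CARD('m)"
  define l where "l = CARD('m) * (CARD('n) - 1)"
  let ?m = "CARD('m)"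
  have m: "0 < ?m" by simp
  have n: "0 < CARD('n)" by simp
  have DIM: "DIM(real ^ 'm ^ 'n) = k" by (simp add: k_def)
  \<comment> \<open>The exponent \<open>l\<close> in \<open>g\<close> is the dimension of the affine
    subspaces, complementary to the codimension \<open>CARD('m)\<close> in the space of
    matrices.\<close>
  have kml: "k = ?m + l" using n by (simp add: k_def l_def algebra_simps)
  then have l: "k - ?m = l" by simp
  have f_pos: "0 < f r" if "0 < r" for r using f that by (simp add: dimension_function_def)
  have g_pos: "0 < g r" if "0 < r" for r using g that by (simp add: dimension_function_def)
  have g_f: "g r * r ^ l = f r" if "0 < r" for r using g_eq[OF that] that by (simp add: l_def)
  define U where "U q = \<psi> q / real q" for q
  define T where "T q = \<theta> q / real q" for q
  have U_pos: "0 < U q" if "1 \<le> q" for q using psi_pos[OF that] that by (simp add: U_def)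
  have T_eq: "T q = g (U q) powr (1 / real ?m)" if "1 \<le> q" for q
    using theta_eq[OF that] that by (simp add: T_def U_def)
  have T_pos: "0 < T q" if "1 \<le> q" for q using T_eq[OF that] g_pos[OF U_pos[OF that]] by simp
  have T_pow: "T q ^ ?m = g (U q)" if "1 \<le> q" for q
    using T_eq[OF that] g_pos[OF U_pos[OF that]] by (simp add: powr_realpow[symmetric] powr_powr)
  have T_pow_f: "T q ^ ?m * U q ^ l = f (U q)" if "1 \<le> q" for q
    using T_pow[OF that] g_f[OF U_pos[OF that]] by simp
  have UT_small: "\<exists>N. \<forall>q\<ge>N. U q < \<epsilon> \<and> T q < \<epsilon>" if e: "0 < \<epsilon>" for \<epsilon>
  proof -
    have "(g \<longlongrightarrow> 0) (at_right 0)" using g by (simp add: dimension_function_def)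
    then have "\<forall>\<^sub>F r in at_right 0. g r < \<epsilon> ^ ?m" using e by (intro order_tendstoD(2)[of g 0]) auto
    then obtain b where b: "b > 0" "\<And>r. 0 < r \<Longrightarrow> r < b \<Longrightarrow> g r < \<epsilon> ^ ?m"
      by (auto simp: eventually_at_right_field)
    have "\<forall>\<^sub>F q in sequentially. U q < min \<epsilon> b"
      unfolding U_def using psi_lim b(1) e by (intro order_tendstoD(2)[of _ 0]) auto
    then obtain N where N: "\<And>q. N \<le> q \<Longrightarrow> U q < min \<epsilon> b" by (auto simp: eventually_sequentially)
    have "U q < \<epsilon> \<and> T q < \<epsilon>" if q: "max N 1 \<le> q" for q
    proof
      show "U q < \<epsilon>" using N[of q] q by simp
      have "T q ^ ?m < \<epsilon> ^ ?m" using T_pow[of q] b(2)[OF U_pos, of q] N[of q] q by simp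
      then show "T q < \<epsilon>" using e by (simp add: power_less_imp_less_base)
    qed
    then show ?thesis by blast
  qed
  obtain N0 where N0: "\<And>q. N0 \<le> q \<Longrightarrow> U q < 1" using UT_small[of 1] by auto

  \<comment> \<open>\<open>Suc\<close> forces \<open>q\<close> to be nonzero, so radii can be
    divided by its norm; the offset \<open>N0\<close> keeps the narrow radii below 1. Shifting tails
    does not change the limsup set.\<close>
  define I where "I N = {(p :: int ^ 'm, q :: int ^ 'n). Suc (N0 + N) \<le> int_sup_norm q \<and>
      append_vec q p \<in> primitive_wrt \<pi>}" for N
  define J :: "(int ^ 'm) \<times> (int ^ 'n) \<Rightarrow> (real ^ 'm ^ 'n) set" where "J = (\<lambda>(p, q). pivot_row q)"
  define h :: "(int ^ 'm) \<times> (int ^ 'n) \<Rightarrow> real ^ 'm ^ 'n \<Rightarrow> real ^ 'm ^ 'n \<Rightarrow> real"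
    where "h = (\<lambda>(p, q). solve_pivot q (real_vec p v* \<Phi> - y))"
  define \<Upsilon> where "\<Upsilon> i = U (int_sup_norm (snd i))" for i :: "(int ^ 'm) \<times> (int ^ 'n)"
  define \<Theta> where "\<Theta> i = T (int_sup_norm (snd i))" for i :: "(int ^ 'm) \<times> (int ^ 'n)"
  have I_norm: "Suc (N0 + N) \<le> int_sup_norm (snd i)" if "i \<in> I N" for i N using that by (auto simp: I_def)
  have I_1: "1 \<le> int_sup_norm (snd i)" if "i \<in> I N" for i N using I_norm[OF that] by simp
  interpret shrinking_slabs J h I \<Upsilon> \<Theta> ?m
  proof
    show "graph_over (J i) (h i)" if "i \<in> I N" for i N
      using I_1[OF that] by (auto simp: J_def h_def graph_over_pivot split: prod.split)
    show "card (J i) = ?m" for i by (simp add: J_def card_pivot_row split: prod.split)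
    show "I N' \<subseteq> I N" if "N \<le> N'" for N N' using that by (auto simp: I_def)
    show "0 < \<Upsilon> i" "0 < \<Theta> i" if "i \<in> I N" for i N
      using I_1[OF that] by (auto simp: \<Upsilon>_def \<Theta>_def U_pos T_pos)
    show "\<exists>N. \<forall>i\<in>I N. \<Upsilon> i < \<epsilon> \<and> \<Theta> i < \<epsilon>" if e: "0 < \<epsilon>" for \<epsilon>
    proof -
      obtain N where N: "\<forall>q\<ge>N. U q < \<epsilon> \<and> T q < \<epsilon>" using UT_small[OF e] by blast
      have "\<Upsilon> i < \<epsilon> \<and> \<Theta> i < \<epsilon>" if "i \<in> I N" for i
        using N I_norm[OF that] by (simp add: \<Upsilon>_def \<Theta>_def)
      then show ?thesis by blast
    qed
  qed

  have level_eq: "level (\<lambda>i. \<phi> (int_sup_norm (snd i)) / real (int_sup_norm (snd i))) N =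
     {x. \<exists>p q. Suc (N0 + N) \<le> int_sup_norm q \<and> append_vec q p \<in> primitive_wrt \<pi> \<and>
        infnorm (real_vec q v* x + real_vec p v* \<Phi> - y) < \<phi> (int_sup_norm q)}" for \<phi> N
  proof -
    have "slab (J (p, q)) (h (p, q)) (\<phi> (int_sup_norm q) / real (int_sup_norm q)) =
       {x. infnorm (real_vec q v* x + real_vec p v* \<Phi> - y) < \<phi> (int_sup_norm q)}"
      if "Suc (N0 + N) \<le> int_sup_norm q" for p q
      unfolding J_def h_def prod.case using that by (subst slab_pivot) (auto simp: add_diff_eq)
    then show ?thesis unfolding level_def I_def by fastforce
  qed
  have approx: "approximable \<pi> y \<Phi> \<phi> =
      unit_cube \<inter> limsup_slabs (\<lambda>i. \<phi> (int_sup_norm (snd i)) / real (int_sup_norm (snd i)))" for \<phi>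
  proof (rule set_eqI)
    fix x :: "real ^ 'm ^ 'n"
    let ?P = "\<lambda>p q. append_vec q p \<in> primitive_wrt \<pi> \<and>
        infnorm (real_vec q v* x + real_vec p v* \<Phi> - y) < \<phi> (int_sup_norm q)"
    have norm0: "int_sup_norm (0 :: int ^ 'n) = 0" by (simp add: int_sup_norm_def)
    have "(\<forall>N. \<exists>p q. (p, q) \<noteq> (0, 0) \<and> N \<le> int_sup_norm q \<and> ?P p q) \<longleftrightarrow>
       (\<forall>N. \<exists>p q. Suc (N0 + N) \<le> int_sup_norm q \<and> ?P p q)"
    proof (intro iffI allI)
      fix N assume "\<forall>N. \<exists>p q. (p, q) \<noteq> (0, 0) \<and> N \<le> int_sup_norm q \<and> ?P p q"
      then show "\<exists>p q. Suc (N0 + N) \<le> int_sup_norm q \<and> ?P p q" by blast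
    next
      fix N assume "\<forall>N. \<exists>p q. Suc (N0 + N) \<le> int_sup_norm q \<and> ?P p q"
      then obtain p q where pq: "Suc (N0 + N) \<le> int_sup_norm q" "?P p q" by blast
      then have "q \<noteq> 0" "N \<le> int_sup_norm q" using norm0 by auto
      then show "\<exists>p q. (p, q) \<noteq> (0, 0) \<and> N \<le> int_sup_norm q \<and> ?P p q" using pq(2) by blast
    qed
    then show "x \<in> approximable \<pi> y \<Phi> \<phi> \<longleftrightarrow> x \<in> unit_cube \<inter>
        limsup_slabs (\<lambda>i. \<phi> (int_sup_norm (snd i)) / real (int_sup_norm (snd i)))"
      unfolding approximable_def limsup_slabs_def level_eq by simp
  qed
  have approx_psi: "approximable \<pi> y \<Phi> \<psi> = unit_cube \<inter> limsup_slabs \<Upsilon>"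
    using approx[of \<psi>] by (simp add: \<Upsilon>_def[abs_def] U_def)
  have approx_theta: "approximable \<pi> y \<Phi> \<theta> = unit_cube \<inter> limsup_slabs \<Theta>"
    using approx[of \<theta>] by (simp add: \<Theta>_def[abs_def] T_def)

  \<comment> \<open>The open cube: its frontier is negligible, and its closure stays inside the
    closed cube.\<close>
  let ?G = "box 0 One :: (real ^ 'm ^ 'n) set"
  let ?M = "approximable \<pi> y \<Phi> \<psi> :: (real ^ 'm ^ 'n) set"
  have cube1: "emeasure lebesgue (unit_cube :: (real ^ 'm ^ 'n) set) = 1"
    by (simp add: emeasure_lborel_cbox_eq)
  have "limsup_slabs \<Theta> \<in> sets borel"
    unfolding limsup_slabs_def using open_level by (intro sets.countable_INT) auto
  then have meas: "(unit_cube \<inter> limsup_slabs \<Theta>) \<in> sets borel" by auto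
  have "emeasure lebesgue (unit_cube - unit_cube \<inter> limsup_slabs \<Theta>) = 0"
    using full_measure[unfolded approx_theta] cube1 meas
    by (subst emeasure_Diff) auto
  then have "negligible (unit_cube - unit_cube \<inter> limsup_slabs \<Theta>)"
    using meas by (auto simp: negligible_iff_null_sets null_sets_def)
  then have full: "negligible (?G - limsup_slabs \<Theta>)"
    by (rule negligible_subset) (use box_subset_cbox in blast)

  show ?thesis
  proof (cases "\<exists>K. \<forall>r. 0 < r \<longrightarrow> r \<le> 1 \<longrightarrow> f r \<le> K * r ^ k")
    case True
    then obtain K where K: "\<And>r. 0 < r \<Longrightarrow> r \<le> 1 \<Longrightarrow> f r \<le> K * r ^ k" by blast
    \<comment> \<open>Being at least 1 and at least \<open>K\<close>, it satisfies
      \<open>K \<le> K' ^ ?m\<close>, so that roots of order \<open>?m\<close> can be taken.\<close>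
    define K' where "K' = max 1 K"
    have "\<Theta> i \<le> K' * \<Upsilon> i" if "i \<in> I 0" for i
    proof -
      let ?q = "int_sup_norm (snd i)"
      have q: "1 \<le> ?q" "U ?q \<le> 1" using I_1[OF that] N0[of ?q] I_norm[OF that] by auto
      have "T ?q ^ ?m * U ?q ^ l \<le> K * U ?q ^ k"
        using T_pow_f[OF q(1)] K[OF U_pos[OF q(1)] q(2)] by simp
      also have "\<dots> = K * U ?q ^ ?m * U ?q ^ l" by (simp add: kml power_add)
      finally have "T ?q ^ ?m \<le> K * U ?q ^ ?m" using U_pos[OF q(1)] by simp
      also have "\<dots> \<le> K' ^ ?m * U ?q ^ ?m"
      proof (rule mult_right_mono)
        have "K \<le> K' ^ 1" by (simp add: K'_def)
        also have "\<dots> \<le> K' ^ ?m" using m by (intro power_increasing) (auto simp: K'_def)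
        finally show "K \<le> K' ^ ?m" .
      qed (use U_pos[OF q(1)] in simp)
      also have "\<dots> = (K' * U ?q) ^ ?m" by (simp add: power_mult_distrib)
      finally show ?thesis
        using U_pos[OF q(1)] T_pos[OF q(1)] m unfolding \<Upsilon>_def \<Theta>_def
        by (subst (asm) power_mono_iff) (auto simp: K'_def)
    qed
    then have "negligible (?G - limsup_slabs \<Upsilon>)"
      by (intro negligible_limsup_comparable[of K'] full) (auto simp: K'_def)
    then have "negligible ((unit_cube - ?G) \<union> (?G - limsup_slabs \<Upsilon>))"
      by (intro negligible_Un negligible_frontier_interval)
    then have "negligible (unit_cube - ?M)"
      by (rule negligible_subset) (auto simp: approx_psi)
    then have "hausdorff_measure f (unit_cube - ?M) = 0"
      by (rule hausdorff_measure_negligible[where K = K]) (use K DIM in auto)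
    then have "hausdorff_measure f (?M \<union> (unit_cube - ?M)) = hausdorff_measure f ?M"
      by (rule hausdorff_measure_Un_null)
    moreover have "?M \<union> (unit_cube - ?M) = unit_cube" by (auto simp: approx_psi)
    ultimately show ?thesis by simp
  next
    case False
    then have unbounded: "\<exists>r. 0 < r \<and> r \<le> 1 \<and> K * r ^ k < f r" for K by (meson not_le)
    \<comment> \<open>An increasing quotient would be bounded on \<open>(0, 1]\<close> by its value
      \<open>f 1\<close> at 1.\<close>
    have "\<not> mono_on {0<..} (\<lambda>r. f r / r ^ k)"
    proof
      assume mono: "mono_on {0<..} (\<lambda>r. f r / r ^ k)"
      obtain r where r: "0 < r" "r \<le> 1" "f 1 * r ^ k < f r" using unbounded by blast
      have "f r / r ^ k \<le> f 1 / 1 ^ k" using mono_onD[OF mono, of r 1] r by simp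
      then show False using r by (simp add: divide_le_eq)
    qed
    then have anti: "antimono_on {0<..} (\<lambda>r. f r / r ^ k)" using monotonic by (simp add: k_def)
    have antimono: "f s * r ^ k \<le> f r * s ^ k" if "0 < r" "r \<le> s" for r s
    proof -
      have "f s / s ^ k \<le> f r / r ^ k" using monotone_onD[OF anti, of r s] that by simp
      then show ?thesis using that by (simp add: field_simps)
    qed
    have mono: "f r * s ^ l \<le> f s * r ^ l" if "0 < r" "r \<le> s" for r s
    proof -
      have "g r \<le> g s" using g that by (auto simp: dimension_function_def intro: mono_onD)
      then have "g r * (r ^ l * s ^ l) \<le> g s * (r ^ l * s ^ l)" using that by (intro mult_right_mono) auto
      then have "(g r * r ^ l) * s ^ l \<le> (g s * s ^ l) * r ^ l" by (simp only: ac_simps)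
      then show ?thesis using g_f[of r] g_f[of s] that by simp
    qed
    interpret mass_transference J h I \<Upsilon> \<Theta> ?m f
    proof (unfold_locales, unfold DIM l)
      show "0 < f r" if "0 < r" for r using that by (rule f_pos)
      show "f s * r ^ k \<le> f r * s ^ k" if "0 < r" "r \<le> s" for r s using that by (rule antimono)
      show "f r * s ^ l \<le> f s * r ^ l" if "0 < r" "r \<le> s" for r s using that by (rule mono)
      show "\<Theta> i ^ ?m * \<Upsilon> i ^ l = f (\<Upsilon> i)" if "i \<in> I N" for i N
        unfolding \<Theta>_def \<Upsilon>_def by (rule T_pow_f[OF I_1[OF that]])
      \<comment> \<open>A radius where the quotient exceeds 1; by monotonicity it does so at all
        smaller radii. There \<open>\<Upsilon> i ^ k \<le> f (\<Upsilon> i)\<close>, and cancelling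
        \<open>\<Upsilon> i ^ l\<close> compares the two radii.\<close>
      obtain r0 where r0: "0 < r0" "r0 \<le> 1" "1 * r0 ^ k < f r0" using unbounded by blast
      obtain N where N: "\<forall>i\<in>I N. \<Upsilon> i < r0 \<and> \<Theta> i < r0" using small[OF r0(1)] by blast
      have "\<Upsilon> i \<le> \<Theta> i" if i: "i \<in> I N" for i
      proof -
        have pos: "0 < \<Upsilon> i" "0 < \<Theta> i" using Upsilon_pos Theta_pos i by auto
        have "\<Upsilon> i ^ k * r0 ^ k \<le> f r0 * \<Upsilon> i ^ k" using r0 pos by simp
        also have "\<dots> \<le> f (\<Upsilon> i) * r0 ^ k" using N i pos by (intro antimono) auto
        finally have "\<Upsilon> i ^ k \<le> f (\<Upsilon> i)" using r0 by simp
        also have "\<dots> = \<Theta> i ^ ?m * \<Upsilon> i ^ l"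
          unfolding \<Theta>_def \<Upsilon>_def by (rule T_pow_f[OF I_1[OF i], symmetric])
        finally have "\<Upsilon> i ^ ?m \<le> \<Theta> i ^ ?m" using pos by (simp add: kml power_add)
        then show ?thesis using pos m by (subst (asm) power_mono_iff) auto
      qed
      then show "\<exists>N. \<forall>i\<in>I N. \<Upsilon> i \<le> \<Theta> i" by blast
    qed
    have "hausdorff_measure f ?M = \<infinity>"
    proof (rule ccontr)
      assume "hausdorff_measure f ?M \<noteq> \<infinity>"
      then have fin: "hausdorff_measure f ?M < \<infinity>" by (simp add: less_top)
      \<comment> \<open>The value 1/2 is below the volume 1 of the open cube, so the cover cannot
        contain almost all of it.\<close>
      obtain u :: "nat \<Rightarrow> real ^ 'm ^ 'n" and r where ur:
        "\<And>i. 0 < r i" "\<And>i. r i \<le> 1" "(\<Sum>i. ennreal (f (r i))) < \<infinity>"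
        "?M \<subseteq> (\<Union>i. ball (u i) (r i))" "emeasure lborel (\<Union>i. ball (u i) (r i)) \<le> ennreal (1/2)"
        by (rule small_ball_cover[OF f _ _ fin, of "1/2", unfolded DIM]) (use antimono unbounded in auto)
      define W where "W = (\<Union>i. ball (u i) (r i))"
      have W: "open W" by (auto simp: W_def)
      have "\<not> negligible (?G - W)"
      proof
        assume "negligible (?G - W)"
        then have "?G - W \<in> null_sets lborel"
          using W by (simp add: negligible_iff_null_sets null_sets_completion_iff)
        then have "emeasure lborel ?G = emeasure lborel (?G - (?G - W))"
          by (intro emeasure_Diff_null_set[symmetric]) auto
        also have "\<dots> \<le> emeasure lborel W" using W by (intro emeasure_mono) auto
        also have "\<dots> \<le> ennreal (1/2)" using ur(5) by (simp only: W_def)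
        finally have "emeasure lborel ?G \<le> ennreal (1/2)" .
        moreover have "emeasure lborel ?G = ennreal 1" by (simp add: emeasure_lborel_box_eq)
        ultimately show False by (simp only: ennreal_le_iff)
      qed
      then have "\<not> closure ?G \<inter> limsup_slabs \<Upsilon> \<subseteq> W"
        by (intro limsup_slabs_not_covered[OF ur(1-3) W_def] full) auto
      moreover have "closure ?G \<subseteq> unit_cube" by (intro closure_minimal box_subset_cbox closed_cbox)
      ultimately show False using ur(4) by (auto simp: approx_psi W_def)
    qed
    moreover have "hausdorff_measure f ?M \<le> hausdorff_measure f (unit_cube :: (real ^ 'm ^ 'n) set)"
      by (rule hausdorff_measure_mono) (auto simp: approx_psi)
    ultimately show ?thesis by (simp add: top_unique)
  qed
qed

end
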